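(* Let $a,b>0$ and let $U\colon\mathbb{R}\to(-\infty,0]$ be given by $U(x)=-ax$ for $x\ge0$ and $U(x)=bx$ for $x<0$. Let $\Phi\colon\mathbb{R}\to\mathbb{R}$ be a convex function for which there are constants $C,\delta\ge0$ such that $|\Phi(x)-\Phi(y)|\le C|x-y|(1+|x|^\delta+|y|^\delta)$ for all $x,y\in\mathbb{R}$. Let $x\in\mathbb{R}$ and $t>0$, and let $p^*(x,t)$ be the unique maximizer in $$V(x,t)=\sup_{p\in\mathbb{R}}\{V(x,t;p,a,b)-\Phi^*(p)\},$$ with $V(x,t;p,a,b)$ the explicit function given in the context and $\Phi^*$ the Legendre-Fenchel transform of $\Phi$. Then the unique optimal trajectory of the optimal control problem $$\inf\left\{\int_0^t\left(\frac{(\dot x(s))^2}{2}-U(x(s))\right)ds+\Phi(x(0))\colon x(t)=x\right\},$$ where the infimum is over Lipschitz functions $x(\cdot)\colon[0,t]\to\mathbb{R}$, is the function $[0,t]\ni s\mapsto\gamma(s;x,t):=\gamma(s;x,t,p^*(x,t),a,b)$, where $\gamma(s;x,t,p,a,b)$ is the explicit trajectory given in the context. Moreover, the optimal value of this problem equals $V(x,t)$.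
   Context: Explicit function. For $a,b>0$, $x,p\in\mathbb{R}$, $t\ge0$, define $V(x,t;p,a,b)$ as follows. If $p\ge0$, then $V(x,t;p,a,b)=f_i(x,t;p,a,b)$ whenever $(x,t,p)\in\Omega_i$, $i=1,\dots,5$, where (the regions depend on $a,b$, are subsets of $\mathbb{R}\times[0,+\infty)\times[0,+\infty)$, and partition it) $\Omega_1=\{x\ge pt+\frac a2t^2\}$; $\Omega_2=\{x<0,\ t<\frac pb\}\cup\{x<-\frac b2(t-\frac pb)^2,\ t\ge\frac pb\}$; $\Omega_3=\{0\le x<pt+\frac a2t^2,\ t<\frac pb\}\cup\{\frac a2(t-\frac pb)^2\le x<pt+\frac a2t^2,\ t\ge\frac pb\}$; $\Omega_4=\{0\le x<\frac a2(t-\frac pb)^2,\ t\ge\frac pb\}$; $\Omega_5=\{-\frac b2(t-\frac pb)^2\le x<0,\ t\ge\frac pb\}$; and $f_1=-\frac{a^2}{6}t^3-\frac a2pt^2+atx-\frac12p^2t+px$; $f_2=-\frac{b^2}{6}t^3+\frac b2pt^2-\frac12p^2t+px-btx$; $f_3=\frac{a+b}{3(a+2b)^2}\left((bt-p)^3+((bt-p)^2+2x(a+2b))^{3/2}\right)-\frac{b}{a+2b}(bt-p)x-\frac{b^2}{6}t^3+\frac b2pt^2-\frac12p^2t$; $f_4=\frac{a^2}{3}\left(\frac{2x}{a}\right)^{3/2}-\frac{p^3}{6b}$; $f_5=\frac{b^2}{3}\left(\frac{-2x}{b}\right)^{3/2}-\frac{p^3}{6b}$. If $p<0$, then $V(x,t;p,a,b)=V(-x,t;-p,b,a)$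 (the right-hand side being given by the case $-p>0$ with $a$ and $b$ exchanged). Explicit trajectory. For $a,b>0$, $x,p\in\mathbb{R}$, $t>0$, $s\in[0,t]$, define $\gamma(s;x,t,p,a,b)$ as follows. If $p\ge0$: - $(x,t,p)\in\Omega_1$: $\gamma=x-p(t-s)-\frac a2(t^2-s^2)$. - $(x,t,p)\in\Omega_2$: $\gamma=x-p(t-s)+\frac b2(t^2-s^2)$. - $(x,t,p)\in\Omega_3$: with $\tau=\frac{(a+b)t+p-\sqrt{(bt-p)^2+2(2b+a)x}}{2b+a}\in[0,t]$, $\gamma=-p(\tau-s)+\frac b2(\tau^2-s^2)$ for $s\in[0,\tau)$ and $\gamma=(p-b\tau)(s-\tau)+\frac a2(s-\tau)^2$ for $s\in[\tau,t]$. - $(x,t,p)\in\Omega_4$: $\gamma=-\frac1{2b}(p-bs)^2$ for $s\in[0,\frac pb)$; $\gamma=0$ for $s\in[\frac pb,t-\sqrt{2x/a})$; $\gamma=\frac a2\left(s-t+\sqrt{2x/a}\right)^2$ for $s\in[t-\sqrt{2x/a},t]$. - $(x,t,p)\in\Omega_5$: $\gamma=-\frac1{2b}(p-bs)^2$ for $s\in[0,\frac pb)$; $\gamma=0$ for $s\in[\frac pb,t-\sqrt{2|x|/b})$; $\gamma=-\frac b2\left(s-t+\sqrt{2|x|/b}\right)^2$ for $s\in[t-\sqrt{2|x|/b},t]$. If $p<0$: $\gamma(s;x,t,p,a,b)=-\gamma(s;-x,t,-p,b,a)$. Other notation. $\Phi^*(p)=\sup_x\{px-\Phi(x)\}\in\mathbb{R}\cup\{+\infty\}$.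 For $t>0$ the maximizer $p^*(x,t)$ exists and is unique. An optimal trajectory is an admissible trajectory attaining the infimum. *)

theory Defs
  imports "HOL-Analysis.Analysis"
begin

text \<open>The regions are sets of triples \<open>(x, t, p)\<close>.\<close>

definition Omega1 :: "real \<Rightarrow> real \<Rightarrow> (real \<times> real \<times> real) set" where
  "Omega1 a b = {(x, t, p). 0 \<le> t \<and> 0 \<le> p \<and> x \<ge> p * t + a / 2 * t\<^sup>2}"

definition Omega2 :: "real \<Rightarrow> real \<Rightarrow> (real \<times> real \<times> real) set" where
  "Omega2 a b = {(x, t, p). 0 \<le> t \<and> 0 \<le> p \<and>
     (x < 0 \<and> t < p / b \<or> x < - (b / 2) * (t - p / b)\<^sup>2 \<and> t \<ge> p / b)}"

definition Omega3 :: "real \<Rightarrow> real \<Rightarrow> (real \<times> real \<times> real) set" where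
  "Omega3 a b = {(x, t, p). 0 \<le> t \<and> 0 \<le> p \<and>
     (0 \<le> x \<and> x < p * t + a / 2 * t\<^sup>2 \<and> t < p / b \<or>
      a / 2 * (t - p / b)\<^sup>2 \<le> x \<and> x < p * t + a / 2 * t\<^sup>2 \<and> t \<ge> p / b)}"

definition Omega4 :: "real \<Rightarrow> real \<Rightarrow> (real \<times> real \<times> real) set" where
  "Omega4 a b = {(x, t, p). 0 \<le> t \<and> 0 \<le> p \<and>
     0 \<le> x \<and> x < a / 2 * (t - p / b)\<^sup>2 \<and> t \<ge> p / b}"

definition Omega5 :: "real \<Rightarrow> real \<Rightarrow> (real \<times> real \<times> real) set" where
  "Omega5 a b = {(x, t, p). 0 \<le> t \<and> 0 \<le> p \<and>
     - (b / 2) * (t - p / b)\<^sup>2 \<le> x \<and> x < 0 \<and> t \<ge> p / b}"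

definition f1 :: "real \<Rightarrow> real \<Rightarrow> real \<Rightarrow> real \<Rightarrow> real \<Rightarrow> real" where
  "f1 x t p a b = - (a\<^sup>2 / 6) * t ^ 3 - a / 2 * p * t\<^sup>2 + a * t * x - 1 / 2 * p\<^sup>2 * t + p * x"

definition f2 :: "real \<Rightarrow> real \<Rightarrow> real \<Rightarrow> real \<Rightarrow> real \<Rightarrow> real" where
  "f2 x t p a b = - (b\<^sup>2 / 6) * t ^ 3 + b / 2 * p * t\<^sup>2 - 1 / 2 * p\<^sup>2 * t + p * x - b * t * x"

definition f3 :: "real \<Rightarrow> real \<Rightarrow> real \<Rightarrow> real \<Rightarrow> real \<Rightarrow> real" where
  "f3 x t p a b =
     (a + b) / (3 * (a + 2 * b)\<^sup>2) *
       ((b * t - p) ^ 3 + ((b * t - p)\<^sup>2 + 2 * x * (a + 2 * b)) powr (3 / 2))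
     - b / (a + 2 * b) * (b * t - p) * x
     - b\<^sup>2 / 6 * t ^ 3 + b / 2 * p * t\<^sup>2 - 1 / 2 * p\<^sup>2 * t"

definition f4 :: "real \<Rightarrow> real \<Rightarrow> real \<Rightarrow> real \<Rightarrow> real \<Rightarrow> real" where
  "f4 x t p a b = a\<^sup>2 / 3 * (2 * x / a) powr (3 / 2) - p ^ 3 / (6 * b)"

definition f5 :: "real \<Rightarrow> real \<Rightarrow> real \<Rightarrow> real \<Rightarrow> real \<Rightarrow> real" where
  "f5 x t p a b = b\<^sup>2 / 3 * (- 2 * x / b) powr (3 / 2) - p ^ 3 / (6 * b)"

text \<open>For \<open>a, b > 0\<close> the regions partition \<open>{(x, t, p). t \<ge> 0 \<and> p \<ge> 0}\<close>
  (lemmas \<open>Omega_cover\<close> and \<open>Omega_disjoint\<close>), so the order of the case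
  distinctions below is immaterial and the last branch is the fifth region.\<close>

lemma Omega_cover:
  assumes "a > 0" "b > 0"
  shows "Omega1 a b \<union> Omega2 a b \<union> Omega3 a b \<union> Omega4 a b \<union> Omega5 a b =
    {(x, t, p). 0 \<le> t \<and> 0 \<le> p}"
  unfolding Omega1_def Omega2_def Omega3_def Omega4_def Omega5_def by auto

lemma Omega_disjoint:
  assumes "a > 0" "b > 0"
  shows "disjoint_family_on
    ((!) [Omega1 a b, Omega2 a b, Omega3 a b, Omega4 a b, Omega5 a b]) {..<5}"
proof -
  have sq: "a / 2 * (t - p / b)\<^sup>2 \<le> p * t + a / 2 * t\<^sup>2"
    if "0 \<le> t" "0 \<le> p" "p / b \<le> t" for t p
  proof -
    have "0 \<le> p / b" using that assms by simp
    hence "(t - p / b)\<^sup>2 \<le> t\<^sup>2" using that by (intro power_mono) auto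
    hence "a / 2 * (t - p / b)\<^sup>2 \<le> a / 2 * t\<^sup>2" using assms by (intro mult_left_mono) auto
    thus ?thesis using that by (smt (verit) mult_nonneg_nonneg)
  qed
  have nn: "0 \<le> p * t + a / 2 * t\<^sup>2" if "0 \<le> t" "0 \<le> p" for t p
    using that assms by simp
  have na: "0 \<le> a / 2 * (t - p / b)\<^sup>2" for t p using assms by simp
  have nb: "- (b / 2) * (t - p / b)\<^sup>2 \<le> 0" for t p using assms by simp
  have d: "Omega1 a b \<inter> Omega2 a b = {}" "Omega1 a b \<inter> Omega3 a b = {}"
    "Omega1 a b \<inter> Omega4 a b = {}" "Omega1 a b \<inter> Omega5 a b = {}"
    "Omega2 a b \<inter> Omega3 a b = {}" "Omega2 a b \<inter> Omega4 a b = {}"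
    "Omega2 a b \<inter> Omega5 a b = {}" "Omega3 a b \<inter> Omega4 a b = {}"
    "Omega3 a b \<inter> Omega5 a b = {}" "Omega4 a b \<inter> Omega5 a b = {}"
    unfolding Omega1_def Omega2_def Omega3_def Omega4_def Omega5_def
    by (safe; smt (verit) sq nn na nb)+
  have s: "{..<5} = {0, Suc 0, Suc (Suc 0), Suc (Suc (Suc 0)), Suc (Suc (Suc (Suc 0)))}"
    by auto
  show ?thesis
    unfolding disjoint_family_on_def s using d by (simp add: Int_commute)
qed

definition V_nonneg :: "real \<Rightarrow> real \<Rightarrow> real \<Rightarrow> real \<Rightarrow> real \<Rightarrow> real" where
  "V_nonneg x t p a b =
    (if (x, t, p) \<in> Omega1 a b then f1 x t p a b
     else if (x, t, p) \<in> Omega2 a b then f2 x t p a b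
     else if (x, t, p) \<in> Omega3 a b then f3 x t p a b
     else if (x, t, p) \<in> Omega4 a b then f4 x t p a b
     else f5 x t p a b)"

definition V_explicit :: "real \<Rightarrow> real \<Rightarrow> real \<Rightarrow> real \<Rightarrow> real \<Rightarrow> real" where
  "V_explicit x t p a b =
    (if p \<ge> 0 then V_nonneg x t p a b else V_nonneg (- x) t (- p) b a)"

definition tau :: "real \<Rightarrow> real \<Rightarrow> real \<Rightarrow> real \<Rightarrow> real \<Rightarrow> real" where
  "tau x t p a b =
    ((a + b) * t + p - sqrt ((b * t - p)\<^sup>2 + 2 * (2 * b + a) * x)) / (2 * b + a)"

definition gamma_nonneg ::
    "real \<Rightarrow> real \<Rightarrow> real \<Rightarrow> real \<Rightarrow> real \<Rightarrow> real \<Rightarrow> real" where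
  "gamma_nonneg s x t p a b =
    (if (x, t, p) \<in> Omega1 a b then x - p * (t - s) - a / 2 * (t\<^sup>2 - s\<^sup>2)
     else if (x, t, p) \<in> Omega2 a b then x - p * (t - s) + b / 2 * (t\<^sup>2 - s\<^sup>2)
     else if (x, t, p) \<in> Omega3 a b then
       (let \<tau> = tau x t p a b in
        if s < \<tau> then - p * (\<tau> - s) + b / 2 * (\<tau>\<^sup>2 - s\<^sup>2)
        else (p - b * \<tau>) * (s - \<tau>) + a / 2 * (s - \<tau>)\<^sup>2)
     else if (x, t, p) \<in> Omega4 a b then
       (if s < p / b then - (1 / (2 * b)) * (p - b * s)\<^sup>2
        else if s < t - sqrt (2 * x / a) then 0
        else a / 2 * (s - t + sqrt (2 * x / a))\<^sup>2)
     else
       (if s < p / b then - (1 / (2 * b)) * (p - b * s)\<^sup>2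
        else if s < t - sqrt (2 * \<bar>x\<bar> / b) then 0
        else - (b / 2) * (s - t + sqrt (2 * \<bar>x\<bar> / b))\<^sup>2))"

definition gamma_explicit ::
    "real \<Rightarrow> real \<Rightarrow> real \<Rightarrow> real \<Rightarrow> real \<Rightarrow> real \<Rightarrow> real" where
  "gamma_explicit s x t p a b =
    (if p \<ge> 0 then gamma_nonneg s x t p a b else - gamma_nonneg s (- x) t (- p) b a)"

definition potential :: "real \<Rightarrow> real \<Rightarrow> real \<Rightarrow> real" where
  "potential a b x = (if x \<ge> 0 then - a * x else b * x)"

text \<open>In the growth condition \<open>\<bar>x\<bar>\<close> to the power \<open>0\<close> is \<open>1\<close>, also for \<open>x = 0\<close>,
  whereas \<open>0 powr 0 = 0\<close>.\<close>

definition abs_pow :: "real \<Rightarrow> real \<Rightarrow> real" where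
  "abs_pow x \<delta> = (if \<delta> = 0 then 1 else \<bar>x\<bar> powr \<delta>)"

definition growth_cond :: "(real \<Rightarrow> real) \<Rightarrow> bool" where
  "growth_cond \<Phi> \<longleftrightarrow> (\<exists>C \<delta>. C \<ge> 0 \<and> \<delta> \<ge> 0 \<and>
    (\<forall>x y. \<bar>\<Phi> x - \<Phi> y\<bar> \<le> C * \<bar>x - y\<bar> * (1 + abs_pow x \<delta> + abs_pow y \<delta>)))"

definition legendre :: "(real \<Rightarrow> real) \<Rightarrow> real \<Rightarrow> ereal" where
  "legendre \<Phi> p = (SUP x. ereal (p * x - \<Phi> x))"

definition dual_objective ::
    "(real \<Rightarrow> real) \<Rightarrow> real \<Rightarrow> real \<Rightarrow> real \<Rightarrow> real \<Rightarrow> real \<Rightarrow> ereal" where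
  "dual_objective \<Phi> a b x t p = ereal (V_explicit x t p a b) - legendre \<Phi> p"

definition V_sup :: "(real \<Rightarrow> real) \<Rightarrow> real \<Rightarrow> real \<Rightarrow> real \<Rightarrow> real \<Rightarrow> ereal" where
  "V_sup \<Phi> a b x t = (SUP p. dual_objective \<Phi> a b x t p)"

definition is_maximizer ::
    "(real \<Rightarrow> real) \<Rightarrow> real \<Rightarrow> real \<Rightarrow> real \<Rightarrow> real \<Rightarrow> real \<Rightarrow> bool" where
  "is_maximizer \<Phi> a b x t p \<longleftrightarrow> dual_objective \<Phi> a b x t p = V_sup \<Phi> a b x t"

definition p_star :: "(real \<Rightarrow> real) \<Rightarrow> real \<Rightarrow> real \<Rightarrow> real \<Rightarrow> real \<Rightarrow> real" where
  "p_star \<Phi> a b x t = (THE p. is_maximizer \<Phi> a b x t p)"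

text \<open>Trajectories are total functions, of which only the restriction to \<open>{0..t}\<close> matters:
  the cost depends on the derivative only almost everywhere in \<open>{0..t}\<close>, and a Lipschitz
  function is differentiable almost everywhere.\<close>

definition admissible :: "real \<Rightarrow> real \<Rightarrow> (real \<Rightarrow> real) set" where
  "admissible x t = {y. (\<exists>L. L-lipschitz_on {0..t} y) \<and> y t = x}"

definition cost ::
    "(real \<Rightarrow> real) \<Rightarrow> real \<Rightarrow> real \<Rightarrow> real \<Rightarrow> (real \<Rightarrow> real) \<Rightarrow> real" where
  "cost \<Phi> a b t y =
    integral {0..t} (\<lambda>s. (deriv y s)\<^sup>2 / 2 - potential a b (y s)) + \<Phi> (y 0)"

definition optimal_value ::
    "(real \<Rightarrow> real) \<Rightarrow> real \<Rightarrow> real \<Rightarrow> real \<Rightarrow> real \<Rightarrow> ereal" where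
  "optimal_value \<Phi> a b x t = (INF y\<in>admissible x t. ereal (cost \<Phi> a b t y))"

definition optimal_trajectory ::
    "(real \<Rightarrow> real) \<Rightarrow> real \<Rightarrow> real \<Rightarrow> real \<Rightarrow> real \<Rightarrow> (real \<Rightarrow> real) \<Rightarrow> bool" where
  "optimal_trajectory \<Phi> a b x t y \<longleftrightarrow>
    y \<in> admissible x t \<and> ereal (cost \<Phi> a b t y) = optimal_value \<Phi> a b x t"

end

theory Submission
  imports Defs
begin

text \<open>
  Since \<open>-U(x) = max (a x) (-b x)\<close> is convex, the problem is convex. For each slope \<open>p\<close> the explicit
  trajectory \<open>\<gamma>\<^sub>p\<close> solves the Euler--Lagrange inclusion \<open>\<gamma>'' \<in> \<partial>(-U)(\<gamma>)\<close> with \<open>\<gamma>'(0) = p\<close> and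
  \<open>\<gamma>(t) = x\<close>, and \<open>V(p)\<close> is its cost for the initial datum \<open>r \<mapsto> p r\<close>. Convexity then gives, for the
  action \<open>C\<close>, every admissible \<open>z\<close> and every \<open>s\<close> in \<open>[0, t]\<close>, the quantitative gap
  \<open>C(z) + p z(0) \<ge> V(p) + (z(s) - \<gamma>\<^sub>p(s))\<^sup>2 / (2 t)\<close>.
  Comparing two slopes shows that \<open>X(p) = \<gamma>\<^sub>p(0)\<close> is nonincreasing and \<open>t\<close>-Lipschitz, hence some \<open>p\<close> is a
  subgradient of \<open>\<Phi>\<close> at \<open>X(p)\<close>. For this \<open>p\<close> the primal and dual values coincide, and the gap yields
  uniqueness of both the maximizer and the optimal trajectory. The boundary term requires the
  fundamental theorem of calculus for Lipschitz functions, which comes from the Radon--Nikodym theorem.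
\<close>

section \<open>Differentiability almost everywhere of Lipschitz functions\<close>

text \<open>Expansion makes \<open>F\<close> an increasing bijection of the line with Borel inverse
  \<open>G\<close>. The Lipschitz bound makes images of null sets null, so the pushforward of
  Lebesgue measure under \<open>G\<close> has a density.\<close>

lemma expanding_lipschitz_density:
  fixes F :: "real \<Rightarrow> real"
  assumes lip: "L-lipschitz_on UNIV F"
    and expand: "\<And>c d. c \<le> d \<Longrightarrow> d - c \<le> F d - F c"
  obtains f :: "real \<Rightarrow> real"
  where "\<And>c d. c \<le> d \<Longrightarrow> (f has_integral F d - F c) {c..d}"
proof -
  have cont: "continuous_on UNIV F" using lip by (rule lipschitz_on_continuous_on)
  have less: "F c < F d \<longleftrightarrow> c < d" for c d using expand[of c d] expand[of d c] by linarith
  hence le: "F c \<le> F d \<longleftrightarrow> c \<le> d" for c d by (meson not_less)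
  have inj: "inj F" proof (rule injI)
    fix c d assume "F c = F d"
    then show "c = d" using le[of c d] le[of d c] by simp
  qed
  have surj: "surj F"
  proof -
    have "y \<in> range F" for y
    proof -
      define r where "r = \<bar>y - F 0\<bar>"
      have "0 \<le> r" "F (-r) \<le> y" "y \<le> F r"
        using expand[of 0 r] expand[of "-r" 0] unfolding r_def by auto
      moreover have "continuous_on {-r..r} F" using cont by (rule continuous_on_subset) simp
      ultimately show ?thesis using IVT'[of F "-r" y r] by fastforce
    qed
    then show ?thesis by blast
  qed
  define G where "G = inv F"
  have FG [simp]: "F (G y) = y" for y unfolding G_def using surj by (simp add: surj_f_inv_f)
  have GF [simp]: "G (F x) = x" for x unfolding G_def using inj by (simp add: inv_f_f)
  have "mono G" by (metis FG le monoI)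
  hence G [measurable]: "G \<in> borel_measurable borel" by (rule borel_measurable_mono)
  \<comment> \<open>\<open>N A\<close> is the Lebesgue measure of \<open>F ` A\<close>, so its density integrates to the increments of \<open>F\<close>.\<close>
  define N where "N = distr lborel borel G"
  have vim: "G -` A = F ` A" for A
  proof
    show "G -` A \<subseteq> F ` A" by (rule subsetI, rule image_eqI[where x = "G _"]) (auto simp only: FG vimage_eq)
  qed auto
  have "emeasure N A = 0" if A: "A \<in> sets lborel" "emeasure lborel A = 0" for A
  proof -
    have "negligible A" using A
      by (auto simp: negligible_iff_null_sets null_sets_completionI)
    have "negligible (F ` A)"
    proof (rule negligible_locally_Lipschitz_image[OF _ \<open>negligible A\<close>])
      fix x assume "x \<in> A"
      have "norm (F y - F x) \<le> L * norm (y - x)" for y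
        using lipschitz_onD[OF lip, of y x] by (simp add: dist_norm)
      then show "\<exists>T B. open T \<and> x \<in> T \<and> (\<forall>y\<in>A \<inter> T. norm (F y - F x) \<le> B * norm (y - x))"
        by blast
    qed simp
    moreover have "F ` A \<in> sets borel" using A measurable_sets[OF G, of A] by (simp add: vim)
    ultimately have "emeasure lborel (F ` A) = 0"
      by (simp add: negligible_iff_null_sets null_sets_completion_iff null_setsD1)
    then show ?thesis using A unfolding N_def by (simp add: emeasure_distr vim)
  qed
  hence ac: "absolutely_continuous lborel N"
    by (auto simp: absolutely_continuous_def null_sets_def N_def)
  have "sets N = sets lborel" by (simp add: N_def)
  from sigma_finite_measure.Radon_Nikodym[OF sigma_finite_lborel ac this]
  obtain h where h [measurable]: "h \<in> borel_measurable lborel" and dens: "density lborel h = N"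
    by blast
  have F_img: "F ` {c..d} = {F c..F d}" for c d
  proof -
    have "y \<in> F ` {c..d}" if "y \<in> {F c..F d}" for y
      using that le[of c "G y"] le[of "G y" d] by (intro image_eqI[of _ _ "G y"]) auto
    then show ?thesis by (auto simp: le)
  qed
  have nn: "(\<integral>\<^sup>+x. h x * indicator {c..d} x \<partial>lborel) = ennreal (F d - F c)" if "c \<le> d" for c d
  proof -
    have "(\<integral>\<^sup>+x. h x * indicator {c..d} x \<partial>lborel) = emeasure N {c..d}"
      unfolding dens[symmetric] by (subst emeasure_density) auto
    also have "\<dots> = emeasure lborel {F c..F d}"
      unfolding N_def by (simp add: emeasure_distr vim F_img)
    finally show ?thesis using that by (simp add: le)
  qed
  \<comment> \<open>A finite integral forces \<open>h\<close> to be finite almost everywhere, so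
    passing to real values by \<open>enn2real\<close> loses nothing.\<close>
  have fin: "AE x in lborel. h x * indicator {c..d} x \<noteq> \<infinity>" if "c \<le> d" for c d
    by (rule nn_integral_noteq_infinite) (auto simp: nn[OF that])
  define f where "f x = enn2real (h x)" for x
  show ?thesis
  proof (rule that[of f])
    fix c d :: real assume cd: "c \<le> d"
    have "(\<integral>\<^sup>+x. ennreal (f x * indicator {c..d} x) \<partial>lborel) = (\<integral>\<^sup>+x. h x * indicator {c..d} x \<partial>lborel)"
    proof (rule nn_integral_cong_AE)
      show "AE x in lborel. ennreal (f x * indicator {c..d} x) = h x * indicator {c..d} x"
        using fin[OF cd]
        by eventually_elim (auto simp: f_def indicator_def ennreal_enn2real_if)
    qed
    hence "((\<lambda>x. f x * indicator {c..d} x) has_integral F d - F c) UNIV"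
      using cd nn[OF cd] le by (intro nn_integral_has_integral) (auto simp: f_def)
    moreover have "(\<lambda>x. f x * indicator {c..d} x) = (\<lambda>x. if x \<in> {c..d} then f x else 0)"
      by (auto simp: indicator_def)
    ultimately show "(f has_integral F d - F c) {c..d}"
      using has_integral_restrict_UNIV by metis
  qed
qed

text \<open>Off a negligible set the averages of \<open>f\<close> over \<open>[x, x + h]\<close>
  tend to \<open>f x\<close>, and these averages are difference quotients of
  \<open>F\<close>.\<close>

lemma AE_right_derivative_indefinite_integral:
  fixes f F :: "real \<Rightarrow> real"
  assumes "\<And>c d. c \<le> d \<Longrightarrow> (f has_integral F d - F c) {c..d}"
  obtains N where "negligible N"
    "\<And>x. x \<notin> N \<Longrightarrow> ((\<lambda>h. (F (x + h) - F x) / h) \<longlongrightarrow> f x) (at_right 0)"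
proof -
  have "f integrable_on cbox c d" for c d
    using assms[of c d] by (cases "c \<le> d") (auto intro: has_integral_integrable)
  then obtain N where N: "negligible N"
    "\<And>x e. \<lbrakk>x \<notin> N; 0 < e\<rbrakk> \<Longrightarrow> \<exists>d>0. \<forall>h. 0 < h \<and> h < d \<longrightarrow>
       norm (integral (cbox x (x + h *\<^sub>R One)) f /\<^sub>R h ^ DIM(real) - f x) < e"
    using integrable_ccontinuous_explicit by blast
  have int: "integral {x..x + h} f = F (x + h) - F x" if "0 < h" for x h
    using assms[of x "x + h"] that by (intro integral_unique) auto
  have "((\<lambda>h. (F (x + h) - F x) / h) \<longlongrightarrow> f x) (at_right 0)" if "x \<notin> N" for x
    unfolding tendsto_iff eventually_at_right_field
  proof safe
    fix e :: real assume "0 < e"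
    with N(2)[OF that] obtain d where "d > 0"
      and d: "\<forall>h. 0 < h \<and> h < d \<longrightarrow> \<bar>integral {x..x + h} f / h - f x\<bar> < e"
      unfolding divide_inverse_commute by fastforce
    then show "\<exists>b>0. \<forall>y>0. y < b \<longrightarrow> dist ((F (x + y) - F x) / y) (f x) < e"
      by (intro exI[of _ d]) (simp add: dist_real_def int[symmetric])
  qed
  with N(1) show ?thesis by (rule that)
qed

text \<open>Left quotients of \<open>F\<close> are right quotients of the reflected function
  \<open>- F (- x)\<close>, whose density is \<open>f (- x)\<close>; this adds a reflected
  exceptional set.\<close>

lemma AE_derivative_indefinite_integral:
  fixes f F :: "real \<Rightarrow> real"
  assumes int: "\<And>c d. c \<le> d \<Longrightarrow> (f has_integral F d - F c) {c..d}"
  obtains N where "negligible N" "\<And>x. x \<notin> N \<Longrightarrow> (F has_real_derivative f x) (at x)"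
proof -
  obtain N where N: "negligible N"
    "\<And>x. x \<notin> N \<Longrightarrow> ((\<lambda>h. (F (x + h) - F x) / h) \<longlongrightarrow> f x) (at_right 0)"
    using AE_right_derivative_indefinite_integral[OF int] by blast
  have "((\<lambda>x. f (- x)) has_integral - F (- d) - - F (- c)) {c..d}" if "c \<le> d" for c d
    using int[of "- d" "- c"] that
    by (subst has_integral_reflect_real[symmetric]) simp
  then obtain M where M: "negligible M"
    "\<And>x. x \<notin> M \<Longrightarrow> ((\<lambda>h. (- F (- (x + h)) - - F (- x)) / h) \<longlongrightarrow> f (- x)) (at_right 0)"
    using AE_right_derivative_indefinite_integral[of "\<lambda>x. f (- x)" "\<lambda>x. - F (- x)"] by blast
  show ?thesis
  proof (rule that[of "N \<union> uminus ` M"])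
    show "negligible (N \<union> uminus ` M)"
      using N(1) M(1) negligible_differentiable_image_negligible[of M uminus] by (auto intro!: negligible_Un derivative_intros)
    fix x assume x: "x \<notin> N \<union> uminus ` M"
    hence "- x \<notin> M" by (metis UnI2 image_eqI minus_minus)
    from M(2)[OF this] have "((\<lambda>h. (F (x + - h) - F x) / - h) \<longlongrightarrow> f x) (at_right 0)"
      by (simp add: minus_divide_left[symmetric] diff_divide_distrib)
    hence "((\<lambda>h. (F (x + h) - F x) / h) \<longlongrightarrow> f x) (at_left 0)"
      by (simp add: at_left_minus[of "0::real"] filterlim_filtermap)
    with N(2)[of x] x show "(F has_real_derivative f x) (at x)"
      unfolding DERIV_def by (intro filterlim_split_at_real) auto
  qed
qed

text \<open>Clamping the argument extends \<open>y\<close> to a Lipschitz function on the line;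
  after a linear tilt the density lemma applies, and the tilt is subtracted again.\<close>

lemma lipschitz_AE_derivative:
  fixes y :: "real \<Rightarrow> real"
  assumes lip: "L-lipschitz_on {c..d} y" and "c \<le> d"
  obtains N where "negligible N" "\<And>s. s \<in> {c<..<d} - N \<Longrightarrow> (y has_real_derivative deriv y s) (at s)"
    "(deriv y has_integral y d - y c) {c..d}"
proof -
  define Y where "Y s = y (max c (min d s))" for s
  have L: "0 \<le> L" using lip by (rule lipschitz_on_nonneg)
  have Ylip: "\<bar>Y r - Y s\<bar> \<le> L * \<bar>r - s\<bar>" for r s
  proof -
    have "\<bar>Y r - Y s\<bar> \<le> L * \<bar>max c (min d r) - max c (min d s)\<bar>"
      unfolding Y_def using lipschitz_onD[OF lip, of "max c (min d r)" "max c (min d s)"] \<open>c \<le> d\<close>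
      by (auto simp: dist_real_def)
    also have "\<dots> \<le> L * \<bar>r - s\<bar>" using L by (intro mult_left_mono) auto
    finally show ?thesis .
  qed
  \<comment> \<open>The linear term makes the function expanding.\<close>
  define F where "F s = Y s + (L + 1) * s" for s
  have "(2 * L + 1)-lipschitz_on UNIV F"
  proof (rule lipschitz_onI)
    fix r s :: real
    have "\<bar>F r - F s\<bar> \<le> \<bar>Y r - Y s\<bar> + \<bar>(L + 1) * (r - s)\<bar>"
      unfolding F_def by (simp add: algebra_simps)
    also have "\<dots> \<le> L * \<bar>r - s\<bar> + (L + 1) * \<bar>r - s\<bar>"
      using Ylip[of r s] L by (simp add: abs_mult)
    finally show "dist (F r) (F s) \<le> (2 * L + 1) * dist r s"
      by (simp add: dist_real_def algebra_simps)
  qed (use L in simp)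
  moreover have "s - r \<le> F s - F r" if "r \<le> s" for r s
    using Ylip[of s r] that unfolding F_def by (simp add: algebra_simps abs_if split: if_splits)
  ultimately obtain f where f: "\<And>r s. r \<le> s \<Longrightarrow> (f has_integral F s - F r) {r..s}"
    using expanding_lipschitz_density by blast
  obtain N where N: "negligible N" "\<And>s. s \<notin> N \<Longrightarrow> (F has_real_derivative f s) (at s)"
    using AE_derivative_indefinite_integral[OF f] by blast
  have der: "(y has_real_derivative f s - (L + 1)) (at s)" if "s \<in> {c<..<d} - N" for s
  proof -
    have "(Y has_real_derivative f s - (L + 1)) (at s)"
    proof -
      have "((\<lambda>s. F s - (L + 1) * s) has_real_derivative f s - (L + 1)) (at s)"
        using N(2)[of s] that by (auto intro!: derivative_eq_intros)
      then show ?thesis by (simp add: F_def)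
    qed
    moreover have "\<forall>\<^sub>F r in nhds s. Y r = y r"
      using eventually_nhds_in_open[of "{c<..<d}" s] that
      by (auto simp: Y_def elim!: eventually_mono)
    ultimately show ?thesis by (simp cong: DERIV_cong_ev)
  qed
  have "((\<lambda>s. f s - (L + 1)) has_integral (F d - F c) - (L + 1) * (d - c)) {c..d}"
    using has_integral_diff[OF f[OF \<open>c \<le> d\<close>] has_integral_const_real[of "L + 1" c d]] \<open>c \<le> d\<close>
    by (simp add: mult.commute)
  hence "((\<lambda>s. f s - (L + 1)) has_integral y d - y c) {c..d}"
    using \<open>c \<le> d\<close> by (simp add: F_def Y_def algebra_simps)
  \<comment> \<open>The endpoints join the exceptional set because \<open>y\<close> is uncontrolled
    outside \<open>[c, d]\<close>, so \<open>deriv y\<close> may be arbitrary at them.\<close>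
  moreover have "negligible (N \<union> {c, d})" using N(1) by (auto intro: negligible_Un)
  moreover have "deriv y s = f s - (L + 1)" if "s \<in> {c..d} - (N \<union> {c, d})" for s
    using der[of s] that by (intro DERIV_imp_deriv) auto
  ultimately have "(deriv y has_integral y d - y c) {c..d}"
    by (rule has_integral_spike[rotated 2])
  moreover have "(y has_real_derivative deriv y s) (at s)" if "s \<in> {c<..<d} - N" for s
    using der[OF that] DERIV_imp_deriv[OF der[OF that]] by simp
  ultimately show ?thesis using that[OF N(1)] by simp
qed

section \<open>The gap inequality for extremals\<close>

lemma lipschitz_DERIV_le:
  fixes f :: "real \<Rightarrow> real"
  assumes lip: "L-lipschitz_on S f" and der: "(f has_real_derivative D) (at s)"
    and S: "open T" "s \<in> T" "T \<subseteq> S"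
  shows "\<bar>D\<bar> \<le> L"
proof (rule tendsto_upperbound)
  show "((\<lambda>r. \<bar>(f r - f s) / (r - s)\<bar>) \<longlongrightarrow> \<bar>D\<bar>) (at s)"
    using der by (intro tendsto_rabs) (simp add: has_field_derivative_iff)
  show "\<forall>\<^sub>F r in at s. \<bar>(f r - f s) / (r - s)\<bar> \<le> L"
    unfolding eventually_at_topological
  proof (intro exI conjI ballI impI)
    fix r assume r: "r \<in> T" "r \<noteq> s"
    hence "\<bar>f r - f s\<bar> \<le> L * \<bar>r - s\<bar>"
      using lipschitz_onD[OF lip, of r s] S by (auto simp: dist_real_def)
    then show "\<bar>(f r - f s) / (r - s)\<bar> \<le> L"
      using r by (simp add: abs_divide divide_le_eq)
  qed (use S in auto)
qed simp

lemma lipschitz_deriv_square_integrable: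
  fixes y :: "real \<Rightarrow> real"
  assumes lip: "L-lipschitz_on {c..d} y"
  shows "(\<lambda>s. (deriv y s)\<^sup>2) integrable_on {c..d}"
proof (cases "c \<le> d")
  case True
  obtain N where N: "negligible N"
    "\<And>s. s \<in> {c<..<d} - N \<Longrightarrow> (y has_real_derivative deriv y s) (at s)"
    "(deriv y has_integral y d - y c) {c..d}"
    using lipschitz_AE_derivative[OF lip True] by blast
  define M where "M = N \<union> {c, d}"
  \<comment> \<open>On \<open>M\<close> the value of \<open>deriv y\<close> is uncontrolled;
    replacing it by 0 keeps the integral and gives a bound valid everywhere.\<close>
  define f where "f s = (if s \<in> M then 0 else deriv y s)" for s
  have M: "negligible M" using N(1) by (auto simp: M_def intro: negligible_Un)
  have "(f has_integral y d - y c) {c..d}"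
    by (rule has_integral_spike[OF M _ N(3)]) (auto simp: f_def)
  hence meas: "f \<in> borel_measurable (lebesgue_on {c..d})"
    by (intro integrable_imp_measurable) (auto simp: integrable_on_def)
  have "(\<lambda>s. (f s)\<^sup>2) integrable_on {c..d}"
  proof (rule measurable_bounded_by_integrable_imp_integrable[where g = "\<lambda>_. L\<^sup>2"])
    show "(\<lambda>s. (f s)\<^sup>2) \<in> borel_measurable (lebesgue_on {c..d})" using meas by measurable
    fix s assume s: "s \<in> {c..d}"
    show "norm ((f s)\<^sup>2) \<le> L\<^sup>2"
    proof (cases "s \<in> M")
      case False
      with s have "s \<in> {c<..<d} - N" by (auto simp: M_def)
      then have "\<bar>deriv y s\<bar> \<le> L"
        using lipschitz_DERIV_le[OF lip N(2), of s "{c<..<d}"] by fastforce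
      then show ?thesis using False abs_le_square_iff[of "deriv y s" L] by (simp add: f_def)
    qed (simp add: f_def)
  qed auto
  then show ?thesis
    by (rule integrable_spike[OF _ M]) (auto simp: f_def)
qed auto

text \<open>Cauchy-Schwarz, obtained by integrating the squared deviation of \<open>deriv h\<close>
  from its mean \<open>m\<close>.\<close>

lemma square_increment_le_integral_deriv:
  fixes h :: "real \<Rightarrow> real"
  assumes lip: "L-lipschitz_on {c..d} h" and "c \<le> d"
  shows "(h d - h c)\<^sup>2 \<le> (d - c) * integral {c..d} (\<lambda>s. (deriv h s)\<^sup>2)"
proof (cases "c = d")
  case False
  define Q where "Q = integral {c..d} (\<lambda>s. (deriv h s)\<^sup>2)"
  define m where "m = (h d - h c) / (d - c)"
  have cd: "c < d" using False \<open>c \<le> d\<close> by simp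
  have D: "(deriv h has_integral h d - h c) {c..d}"
    using lipschitz_AE_derivative[OF lip \<open>c \<le> d\<close>] by blast
  have "((\<lambda>s. (deriv h s)\<^sup>2) has_integral Q) {c..d}"
    unfolding Q_def using lipschitz_deriv_square_integrable[OF lip] by blast
  hence "((\<lambda>s. (deriv h s)\<^sup>2 - 2 * m * deriv h s + m\<^sup>2) has_integral
      Q - 2 * m * (h d - h c) + m\<^sup>2 * (d - c)) {c..d}"
    using cd has_integral_const_real[of "m\<^sup>2" c d]
    by (intro has_integral_add has_integral_diff has_integral_mult_right D)
       (auto simp: mult.commute)
  moreover have "(\<lambda>s. (deriv h s)\<^sup>2 - 2 * m * deriv h s + m\<^sup>2) = (\<lambda>s. (deriv h s - m)\<^sup>2)"
    by (auto simp: power2_eq_square algebra_simps)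
  ultimately have "0 \<le> Q - 2 * m * (h d - h c) + m\<^sup>2 * (d - c)"
    by (metis (no_types, lifting) has_integral_nonneg zero_le_power2)
  also have "\<dots> = Q - (h d - h c)\<^sup>2 / (d - c)"
  proof -
    have "m * (d - c) = h d - h c" using cd by (simp add: m_def)
    hence "m\<^sup>2 * (d - c) = m * (h d - h c)" by (simp add: power2_eq_square mult.assoc)
    moreover have "m * (h d - h c) = (h d - h c)\<^sup>2 / (d - c)" by (simp add: m_def power2_eq_square)
    ultimately show ?thesis by simp
  qed
  finally show ?thesis using cd by (simp add: Q_def field_simps)
qed simp

lemma DERIV_bounded_imp_lipschitz_on:
  fixes y v :: "real \<Rightarrow> real"
  assumes "\<And>s. s \<in> {c..d} \<Longrightarrow> (y has_real_derivative v s) (at s)"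
    and "continuous_on {c..d} v"
  obtains L where "L-lipschitz_on {c..d} y"
proof -
  have "bounded (v ` {c..d})"
    using assms(2) by (intro compact_imp_bounded compact_continuous_image) auto
  then obtain B where B: "B > 0" "\<And>s. s \<in> {c..d} \<Longrightarrow> norm (v s) \<le> B"
    by (auto simp: bounded_pos)
  have "norm (y r - y s) \<le> B * norm (r - s)" if "r \<in> {c..d}" "s \<in> {c..d}" for r s
    using assms(1) B(2) that
    by (intro field_differentiable_bound[of "{c..d}" y v]) (auto intro: has_field_derivative_at_within)
  with B(1) have "B-lipschitz_on {c..d} y"
    by (intro lipschitz_onI) (auto simp: dist_norm)
  then show ?thesis by (rule that)
qed

text \<open>Lets the fundamental theorem of calculus apply to \<open>v * (z - y)\<close> in the gap
  inequality.\<close>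

lemma lipschitz_on_mult_real:
  fixes f g :: "real \<Rightarrow> real"
  assumes f: "K-lipschitz_on {c..d} f" and g: "L-lipschitz_on {c..d} g"
  obtains M where "M-lipschitz_on {c..d} (\<lambda>s. f s * g s)"
proof -
  have bdd: "\<exists>B\<ge>0. \<forall>s\<in>{c..d}. \<bar>u s\<bar> \<le> B" if "J-lipschitz_on {c..d} u" for J and u :: "real \<Rightarrow> real"
  proof -
    have "bounded (u ` {c..d})"
      by (intro compact_imp_bounded compact_continuous_image lipschitz_on_continuous_on[OF that]) auto
    then show ?thesis by (auto simp: bounded_pos intro: less_imp_le)
  qed
  obtain A B where A: "A \<ge> 0" "\<And>s. s \<in> {c..d} \<Longrightarrow> \<bar>f s\<bar> \<le> A"
    and B: "B \<ge> 0" "\<And>s. s \<in> {c..d} \<Longrightarrow> \<bar>g s\<bar> \<le> B"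
    using bdd[OF f] bdd[OF g] by blast
  have K: "K \<ge> 0" and L: "L \<ge> 0" using f g by (auto intro: lipschitz_on_nonneg)
  have "(A * L + B * K)-lipschitz_on {c..d} (\<lambda>s. f s * g s)"
  proof (rule lipschitz_onI)
    fix r s assume rs: "r \<in> {c..d}" "s \<in> {c..d}"
    have "\<bar>f r * g r - f s * g s\<bar> = \<bar>f r * (g r - g s) + g s * (f r - f s)\<bar>"
      by (simp add: algebra_simps)
    also have "\<dots> \<le> \<bar>f r\<bar> * \<bar>g r - g s\<bar> + \<bar>g s\<bar> * \<bar>f r - f s\<bar>"
      by (metis abs_mult abs_triangle_ineq)
    also have "\<dots> \<le> A * (L * \<bar>r - s\<bar>) + B * (K * \<bar>r - s\<bar>)"
      using A B rs lipschitz_onD[OF f rs] lipschitz_onD[OF g rs]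
      by (intro add_mono mult_mono) (auto simp: dist_real_def)
    finally show "dist (f r * g r) (f s * g s) \<le> (A * L + B * K) * dist r s"
      by (simp add: dist_real_def algebra_simps)
  qed (use A B K L in auto)
  then show ?thesis by (rule that)
qed

text \<open>Kept apart from the initial cost, so that it can be paired with
  \<open>\<Phi> (y 0)\<close> in the primal problem and with the linear datum \<open>p * y 0\<close>
  in the dual one.\<close>

definition action :: "(real \<Rightarrow> real) \<Rightarrow> real \<Rightarrow> (real \<Rightarrow> real) \<Rightarrow> real" where
  "action g t y = integral {0..t} (\<lambda>s. (deriv y s)\<^sup>2 / 2 + g (y s))"

lemma action_integrable:
  fixes g y :: "real \<Rightarrow> real"
  assumes g: "continuous_on UNIV g" and lip: "L-lipschitz_on {0..t} y"
  shows "(\<lambda>s. (deriv y s)\<^sup>2 / 2 + g (y s)) integrable_on {0..t}"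
proof (rule integrable_add)
  show "(\<lambda>s. (deriv y s)\<^sup>2 / 2) integrable_on {0..t}"
    using lipschitz_deriv_square_integrable[OF lip] by (rule integrable_on_divide)
  show "(\<lambda>s. g (y s)) integrable_on {0..t}"
    by (intro integrable_continuous_real continuous_on_compose2[OF g lipschitz_on_continuous_on[OF lip]]) auto
qed

text \<open>Convexity of the integrand bounds the difference of the two actions from below by the integral
  of the derivative of \<open>v (z - y)\<close>, up to the remainder \<open>(z' - v)\<^sup>2 / 2\<close>; the latter controls
  \<open>z - y\<close> because \<open>z\<close> and \<open>y\<close> agree at \<open>t\<close>.\<close>

lemma action_extremal_gap:
  fixes g y v w z :: "real \<Rightarrow> real"
  assumes "t > 0" and g: "continuous_on UNIV g"
    and y: "\<And>s. s \<in> {0..t} \<Longrightarrow> (y has_real_derivative v s) (at s)"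
    and v: "K-lipschitz_on {0..t} v"
    and S: "finite S"
    and w: "\<And>s. s \<in> {0<..<t} - S \<Longrightarrow> (v has_real_derivative w s) (at s)"
    and sub: "\<And>s r. s \<in> {0<..<t} - S \<Longrightarrow> g (y s) + w s * (r - y s) \<le> g r"
    and z: "L-lipschitz_on {0..t} z" and zt: "z t = y t"
    and r: "r \<in> {0..t}"
  shows "action g t y + v 0 * y 0 + (z r - y r)\<^sup>2 / (2 * t) \<le> action g t z + v 0 * z 0"
proof -
  have "0 \<le> t" using \<open>t > 0\<close> by simp
  obtain Ly where ylip: "Ly-lipschitz_on {0..t} y"
    using DERIV_bounded_imp_lipschitz_on[OF y lipschitz_on_continuous_on[OF v]] by blast
  define h where "h s = z s - y s" for s
  define P where "P s = v s * h s" for s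
  have hlip: "(L + Ly)-lipschitz_on {0..t} h"
    unfolding h_def using z ylip by (rule lipschitz_on_diff)
  obtain LP where Plip: "LP-lipschitz_on {0..t} P"
    unfolding P_def using lipschitz_on_mult_real[OF v hlip] by blast
  obtain N where N: "negligible N"
    "\<And>s. s \<in> {0<..<t} - N \<Longrightarrow> (z has_real_derivative deriv z s) (at s)"
    using lipschitz_AE_derivative[OF z \<open>0 \<le> t\<close>] by blast
  define M where "M = N \<union> S \<union> {0, t}"
  have M: "negligible M" using N(1) S by (auto simp: M_def intro: negligible_Un negligible_finite)
  \<comment> \<open>Since \<open>z\<close> and \<open>y\<close> agree at \<open>t\<close>, only the
    boundary term at time 0 survives.\<close>
  have P: "(deriv P has_integral - v 0 * h 0) {0..t}"
  proof -
    have "(deriv P has_integral P t - P 0) {0..t}"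
      using lipschitz_AE_derivative[OF Plip \<open>0 \<le> t\<close>] by blast
    then show ?thesis using zt by (simp add: P_def h_def)
  qed
  define Q where "Q = integral {0..t} (\<lambda>s. (deriv h s)\<^sup>2)"
  have Q: "((\<lambda>s. (deriv h s)\<^sup>2) has_integral Q) {0..t}"
    unfolding Q_def using lipschitz_deriv_square_integrable[OF hlip] by blast
  \<comment> \<open>The kinetic term is expanded exactly around \<open>v\<close>; its cross term and
    the subgradient term \<open>w s * h s\<close> add up to \<open>deriv P s\<close>.\<close>
  have pointwise: "(deriv y s)\<^sup>2 / 2 + g (y s) + ((deriv h s)\<^sup>2 / 2 + deriv P s)
      \<le> (deriv z s)\<^sup>2 / 2 + g (z s)" if "s \<in> {0..t} - M" for s
  proof -
    have s: "s \<in> {0<..<t} - N" "s \<in> {0<..<t} - S" "s \<in> {0..t}" using that by (auto simp: M_def)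
    have h': "(h has_real_derivative deriv z s - v s) (at s)"
      unfolding h_def using N(2)[OF s(1)] y[OF s(3)] by (rule DERIV_diff)
    have "(P has_real_derivative w s * h s + (deriv z s - v s) * v s) (at s)"
      unfolding P_def using w[OF s(2)] h' by (rule DERIV_mult)
    hence "deriv P s = w s * h s + (deriv z s - v s) * v s" by (rule DERIV_imp_deriv)
    moreover have "deriv h s = deriv z s - v s" using h' by (rule DERIV_imp_deriv)
    moreover have "deriv y s = v s" using y[OF s(3)] by (rule DERIV_imp_deriv)
    moreover have "g (y s) + w s * h s \<le> g (z s)" using sub[OF s(2), of "z s"] by (simp add: h_def)
    moreover have "(v s)\<^sup>2 / 2 + ((deriv z s - v s)\<^sup>2 / 2 + (w s * h s + (deriv z s - v s) * v s))
        = (deriv z s)\<^sup>2 / 2 + w s * h s"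
      by (simp add: power2_eq_square field_simps)
    ultimately show ?thesis by simp
  qed
  have "action g t y + (Q / 2 + - v 0 * h 0) \<le> action g t z"
  \<comment> \<open>The comparison is needed at every point of the interval, so both integrands are
    set to 0 on the negligible set \<open>M\<close>.\<close>
  proof (rule has_integral_le)
    let ?f = "\<lambda>s. (deriv y s)\<^sup>2 / 2 + g (y s) + ((deriv h s)\<^sup>2 / 2 + deriv P s)"
    let ?k = "\<lambda>s. (deriv z s)\<^sup>2 / 2 + g (z s)"
    have "(?f has_integral action g t y + (Q / 2 + - v 0 * h 0)) {0..t}"
      unfolding action_def
      by (intro has_integral_add has_integral_divide P Q integrable_integral action_integrable[OF g ylip])
    then show "((\<lambda>s. if s \<in> M then 0 else ?f s) has_integral action g t y + (Q / 2 + - v 0 * h 0)) {0..t}"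
      by (rule has_integral_spike[OF M, rotated]) auto
    have "(?k has_integral action g t z) {0..t}"
      unfolding action_def by (intro integrable_integral action_integrable[OF g z])
    then show "((\<lambda>s. if s \<in> M then 0 else ?k s) has_integral action g t z) {0..t}"
      by (rule has_integral_spike[OF M, rotated]) auto
  qed (use pointwise in auto)
  \<comment> \<open>Because \<open>h\<close> vanishes at \<open>t\<close>, its value at
    \<open>r\<close> is an increment over \<open>[r, t]\<close>.\<close>
  moreover have "(h r)\<^sup>2 / (2 * t) \<le> Q / 2"
  proof -
    have sub: "{r..t} \<subseteq> {0..t}" using r by auto
    note hr = lipschitz_on_subset[OF hlip sub]
    have "(h r)\<^sup>2 \<le> (t - r) * integral {r..t} (\<lambda>s. (deriv h s)\<^sup>2)"
      using square_increment_le_integral_deriv[OF hr] r zt by (simp add: h_def power2_commute)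
    also have "\<dots> \<le> t * Q"
      unfolding Q_def using r
      by (intro mult_mono integral_subset_le sub lipschitz_deriv_square_integrable[OF hr]
          lipschitz_deriv_square_integrable[OF hlip] integral_nonneg) auto
    finally show ?thesis using \<open>t > 0\<close> by (simp add: field_simps)
  qed
  ultimately show ?thesis by (simp add: h_def algebra_simps)
qed

section \<open>Duality for a convex initial cost\<close>

text \<open>Chord slopes of a convex function increase to the right, here without division;
  \<open>m\<close> is the weight of \<open>w\<close> in writing \<open>v\<close> as a convex
  combination.\<close>

lemma convex_on_three_points:
  fixes f :: "real \<Rightarrow> real"
  assumes f: "convex_on UNIV f" and "u < v" "v < w"
  shows "(f v - f u) * (w - v) \<le> (f w - f v) * (v - u)"
proof -
  define m where "m = (v - u) / (w - u)"
  have wu: "w - u > 0" using assms by simp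
  have m: "0 \<le> m" "m \<le> 1" using assms by (auto simp: m_def)
  have m1: "m * (w - u) = v - u" using wu by (simp add: m_def)
  hence "(1 - m) * u + m * w = v" by (simp add: algebra_simps)
  hence "f v \<le> (1 - m) * f u + m * f w"
    using convex_onD[OF f m, of u w] by simp
  hence "f v * (w - u) \<le> ((1 - m) * f u + m * f w) * (w - u)"
    using wu by (intro mult_right_mono) auto
  also have "\<dots> = f u * (w - u) + (f w - f u) * (m * (w - u))" by (simp add: algebra_simps)
  finally show ?thesis unfolding m1 by (simp add: algebra_simps)
qed

text \<open>As \<open>p\<close> grows, \<open>X p\<close> moves left and the subgradients there do
  not grow, while \<open>p\<close> itself passes from below them to above them; continuity and
  connectedness prevent it from skipping them all.\<close>

lemma ex_subgradient_along_antimono: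
  fixes f X :: "real \<Rightarrow> real"
  assumes f: "convex_on UNIV f" and X: "continuous_on UNIV X" "antimono X"
  obtains p where "\<And>w. f (X p) + p * (w - X p) \<le> f w"
proof -
  have fcont: "continuous_on UNIV f" using f by (intro convex_on_continuous) auto
  have fX: "continuous_on UNIV (\<lambda>p. f (X p))"
    by (rule continuous_on_compose2[OF fcont X(1)]) auto
  \<comment> \<open>\<open>A\<close> and \<open>B\<close> are the slopes that are too large and too small; they are open, disjoint and
    nonempty, so they cannot cover the line.\<close>
  define A where "A = (\<Union>w. {p. X p < w \<and> f w - f (X p) < p * (w - X p)})"
  define B where "B = (\<Union>w. {p. w < X p \<and> f w - f (X p) < p * (w - X p)})"
  have "open A" "open B"
    unfolding A_def B_def
    by (intro open_UN ballI open_Collect_conj open_Collect_less continuous_intros X(1) fX)+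
  moreover have "A \<inter> B \<inter> UNIV = {}"
  proof -
    have False if "X p < w" "f w - f (X p) < p * (w - X p)"
      "u < X p" "f u - f (X p) < p * (u - X p)" for p u w
    proof -
      have "(f w - f (X p)) * (X p - u) < p * (w - X p) * (X p - u)"
        using that by (intro mult_strict_right_mono) auto
      moreover have "p * (X p - u) * (w - X p) < (f (X p) - f u) * (w - X p)"
        using that by (intro mult_strict_right_mono) (auto simp: algebra_simps)
      ultimately show False
        using convex_on_three_points[OF f that(3) that(1)] by (simp add: mult_ac)
    qed
    then show ?thesis by (auto simp: A_def B_def)
  qed
  moreover have "A \<noteq> {}"
  proof -
    define w where "w = X 0 + 1"
    \<comment> \<open>A nonnegative \<open>p\<close> keeps \<open>X p\<close> below
      \<open>w\<close>, and the chord slope over \<open>[w, w + 1]\<close> dominates that over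
      \<open>[X p, w]\<close>, so exceeding it makes \<open>p\<close> too large.\<close>
    define p where "p = max 0 (f (w + 1) - f w) + 1"
    have "X p \<le> X 0" using X(2) by (auto simp: p_def antimono_def)
    hence Xp: "X p < w" by (simp add: w_def)
    have "f w - f (X p) \<le> (f (w + 1) - f w) * (w - X p)"
      using convex_on_three_points[OF f Xp, of "w + 1"] by simp
    also have "\<dots> < p * (w - X p)"
      using Xp by (intro mult_strict_right_mono) (auto simp: p_def)
    finally have "p \<in> A" using Xp by (auto simp: A_def)
    then show ?thesis by blast
  qed
  moreover have "B \<noteq> {}"
  proof -
    define u where "u = X 0 - 1"
    define p where "p = min 0 (f u - f (u - 1)) - 1"
    have "X 0 \<le> X p" using X(2) by (auto simp: p_def antimono_def)
    hence Xp: "u < X p" by (simp add: u_def)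
    have "p * (X p - u) < (f u - f (u - 1)) * (X p - u)"
      using Xp by (intro mult_strict_right_mono) (auto simp: p_def)
    also have "\<dots> \<le> f (X p) - f u"
      using convex_on_three_points[OF f _ Xp, of "u - 1"] by simp
    finally have "p \<in> B" using Xp by (auto simp: B_def algebra_simps)
    then show ?thesis by blast
  qed
  ultimately have "\<not> UNIV \<subseteq> A \<union> B"
    using connectedD[OF connected_UNIV, of A B] by auto
  then obtain p where p: "p \<notin> A" "p \<notin> B" by blast
  have "p * (w - X p) \<le> f w - f (X p)" for w
  proof (rule ccontr)
    assume "\<not> ?thesis"
    hence less: "f w - f (X p) < p * (w - X p)" by simp
    hence "X p < w \<or> w < X p" by (cases w "X p" rule: linorder_cases) auto
    with less have "p \<in> A \<union> B" unfolding A_def B_def by blast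
    with p show False by blast
  qed
  hence "f (X p) + p * (w - X p) \<le> f w" for w by (simp add: le_diff_eq add.commute)
  then show ?thesis by (rule that)
qed

section \<open>Weak duality and attainment of the dual supremum\<close>

lemma ereal_diff_legendre_le:
  "ereal c - legendre \<Phi> p \<le> ereal (c - (p * r - \<Phi> r))"
proof -
  have "ereal (p * r - \<Phi> r) \<le> legendre \<Phi> p"
    unfolding legendre_def by (rule SUP_upper) simp
  then show ?thesis
    using ereal_minus_mono[of "ereal c" "ereal c" "ereal (p * r - \<Phi> r)"] by simp
qed

lemma legendre_eq_subgradient:
  assumes "\<And>w. \<Phi> z + p * (w - z) \<le> \<Phi> w"
  shows "legendre \<Phi> p = ereal (p * z - \<Phi> z)"
  unfolding legendre_def
proof (rule antisym)
  show "(SUP w. ereal (p * w - \<Phi> w)) \<le> ereal (p * z - \<Phi> z)"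
    using assms by (intro SUP_least) (simp add: algebra_simps)
qed (rule SUP_upper, simp)

text \<open>Separates duality from the dynamics: \<open>C\<close> is any functional on a class
  \<open>A\<close> for which the gap inequality holds. If \<open>p\<close> is a subgradient of
  \<Phi> at the starting point of \<open>\<gamma> p\<close>, then \<open>D p\<close> equals the
  primal cost of \<open>\<gamma> p\<close>, which closes the duality gap.\<close>

lemma dual_attainment:
  fixes \<Phi> V :: "real \<Rightarrow> real" and \<gamma> :: "real \<Rightarrow> real \<Rightarrow> real" and C :: "(real \<Rightarrow> real) \<Rightarrow> real"
  defines "D \<equiv> \<lambda>p. ereal (V p) - legendre \<Phi> p"
  assumes \<Phi>: "convex_on UNIV \<Phi>" and t: "t > 0"
    and adm: "\<And>p. \<gamma> p \<in> A"
    and gap: "\<And>p z s. z \<in> A \<Longrightarrow> s \<in> {0..t} \<Longrightarrow> V p + (z s - \<gamma> p s)\<^sup>2 / (2 * t) \<le> C z + p * z 0"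
    and val: "\<And>p. V p = C (\<gamma> p) + p * \<gamma> p 0"
    and inj: "\<And>p q. (\<And>s. s \<in> {0..t} \<Longrightarrow> \<gamma> p s = \<gamma> q s) \<Longrightarrow> p = q"
  obtains p where
    "\<And>q. D q = (SUP r. D r) \<longleftrightarrow> q = p"
    "ereal (C (\<gamma> p) + \<Phi> (\<gamma> p 0)) = (SUP r. D r)"
    "\<And>z. z \<in> A \<Longrightarrow> (SUP r. D r) \<le> ereal (C z + \<Phi> (z 0))"
    "\<And>z s. z \<in> A \<Longrightarrow> ereal (C z + \<Phi> (z 0)) = (SUP r. D r) \<Longrightarrow> s \<in> {0..t} \<Longrightarrow> z s = \<gamma> p s"
proof -
  define X where "X p = \<gamma> p 0" for p
  have gap_le: "V p \<le> C z + p * z 0" if "z \<in> A" for z p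
  proof -
    have "0 \<le> (z 0 - \<gamma> p 0)\<^sup>2 / (2 * t)" using t by simp
    moreover have "V p + (z 0 - \<gamma> p 0)\<^sup>2 / (2 * t) \<le> C z + p * z 0" using gap[OF that] t by simp
    ultimately show ?thesis by linarith
  qed
  have gap_eq: "z s = \<gamma> p s" if "z \<in> A" "C z + p * z 0 \<le> V p" "s \<in> {0..t}" for z p s
  proof -
    have "(z s - \<gamma> p s)\<^sup>2 / (2 * t) \<le> 0" using gap[OF that(1,3), of p] that(2) by simp
    then show ?thesis using t by (simp add: divide_le_0_iff)
  qed
  \<comment> \<open>Testing the gap for \<open>p\<close> with \<open>\<gamma> q\<close> and the gap
    for \<open>q\<close> with \<open>\<gamma> p\<close>, then adding, cancels both values of
    \<open>C\<close>.\<close>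
  have mono: "(X q - X p)\<^sup>2 \<le> t * ((p - q) * (X q - X p))" for p q
  proof -
    have "V p + (X q - X p)\<^sup>2 / (2 * t) \<le> C (\<gamma> q) + p * X q"
      "V q + (X p - X q)\<^sup>2 / (2 * t) \<le> C (\<gamma> p) + q * X p"
      using gap[OF adm, of 0] t by (auto simp: X_def)
    hence "(X q - X p)\<^sup>2 / (2 * t) + (X p - X q)\<^sup>2 / (2 * t) \<le> (p - q) * (X q - X p)"
      unfolding val by (simp add: X_def algebra_simps)
    moreover have "(X p - X q)\<^sup>2 = (X q - X p)\<^sup>2" by (rule power2_commute)
    ultimately show ?thesis using t by (simp add: field_simps)
  qed
  have "antimono X"
  proof (rule antimonoI, rule ccontr)
    fix p q assume "p \<le> q" "\<not> X q \<le> X p"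
    hence "t * ((p - q) * (X q - X p)) \<le> 0" "0 < (X q - X p)\<^sup>2"
      using t by (auto simp: mult_le_0_iff)
    with mono[of q p] show False by simp
  qed
  moreover have "continuous_on UNIV X"
  proof -
    have "\<bar>X q - X p\<bar> \<le> t * \<bar>q - p\<bar>" for p q
    proof (cases "X q = X p")
      case False
      have "\<bar>X q - X p\<bar> * \<bar>X q - X p\<bar> \<le> \<bar>t * ((p - q) * (X q - X p))\<bar>"
        using mono[of q p] by (simp add: power2_eq_square flip: abs_mult)
      also have "\<dots> = t * \<bar>q - p\<bar> * \<bar>X q - X p\<bar>" using t by (simp add: abs_mult abs_minus_commute)
      finally show ?thesis by (rule mult_right_le_imp_le) (use False in simp)
    qed (use t in simp)
    hence "t-lipschitz_on UNIV X" using t by (intro lipschitz_onI) (auto simp: dist_real_def)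
    then show ?thesis by (rule lipschitz_on_continuous_on)
  qed
  ultimately obtain p where p: "\<And>w. \<Phi> (X p) + p * (w - X p) \<le> \<Phi> w"
    using ex_subgradient_along_antimono[OF \<Phi>] by blast
  have weak: "D q \<le> ereal (V q - (q * r - \<Phi> r))" for q r
    unfolding D_def by (rule ereal_diff_legendre_le)
  have upper: "(SUP r. D r) \<le> ereal (C z + \<Phi> (z 0))" if "z \<in> A" for z
  proof (rule SUP_least)
    fix q
    have "V q - (q * z 0 - \<Phi> (z 0)) \<le> C z + \<Phi> (z 0)" using gap_le[OF that, of q] by simp
    then show "D q \<le> ereal (C z + \<Phi> (z 0))" using weak[of q "z 0"] by (meson ereal_less_eq(3) order_trans)
  qed
  have Dp: "D p = ereal (C (\<gamma> p) + \<Phi> (X p))"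
    using val[of p] legendre_eq_subgradient[of \<Phi> "X p" p, OF p] by (simp add: D_def X_def)
  have sup: "(SUP r. D r) = ereal (C (\<gamma> p) + \<Phi> (X p))"
    using upper[OF adm[of p]] Dp SUP_upper[of p UNIV D] by (intro antisym) (auto simp: X_def)
  show ?thesis
  proof (rule that[of p])
    fix q
    show "D q = (SUP r. D r) \<longleftrightarrow> q = p"
    proof
      \<comment> \<open>Weak duality for a maximal \<open>q\<close>, tested at \<open>X p\<close>,
        shows that \<open>\<gamma> p\<close> attains \<open>V q\<close>; the gap then identifies it
        with \<open>\<gamma> q\<close>.\<close>
      assume "D q = (SUP r. D r)"
      hence "C (\<gamma> p) + q * \<gamma> p 0 \<le> V q"
        using weak[of q "X p"] unfolding sup X_def by simp
      hence "\<gamma> p s = \<gamma> q s" if "s \<in> {0..t}" for s using gap_eq[OF adm _ that] by blast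
      then show "q = p" by (rule inj[symmetric])
    qed (use Dp sup in simp)
  next
    show "ereal (C (\<gamma> p) + \<Phi> (\<gamma> p 0)) = (SUP r. D r)" using sup by (simp add: X_def)
  next
    fix z s assume z: "z \<in> A" "ereal (C z + \<Phi> (z 0)) = (SUP r. D r)" and s: "s \<in> {0..t}"
    \<comment> \<open>The subgradient inequality at \<open>X p\<close> trades \<Phi> for the linear
      datum, so an optimal \<open>z\<close> also attains \<open>V p\<close>.\<close>
    have "C z + p * z 0 \<le> V p"
      using z(2) sup p[of "z 0"] val[of p] by (simp add: X_def algebra_simps)
    then show "z s = \<gamma> p s" using z(1) s by (intro gap_eq)
  qed (rule upper)
qed

section \<open>Piecewise quadratic extremals\<close>

text \<open>Truncated squares have no kink at zero, so they can switch an acceleration on or off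
  while the velocity stays continuous.\<close>

lemma DERIV_max_zero_square:
  fixes f :: "real \<Rightarrow> real"
  assumes "(f has_real_derivative f') (at s within S)"
  shows "((\<lambda>s. (max 0 (f s))\<^sup>2) has_real_derivative 2 * max 0 (f s) * f') (at s within S)"
proof -
  have "((\<lambda>u. (max 0 u)\<^sup>2) has_real_derivative 2 * max 0 u) (at u)" for u :: real
  proof (cases u "0 :: real" rule: linorder_cases)
    case less
    have "\<forall>\<^sub>F r in nhds u. (max 0 r)\<^sup>2 = 0"
      using eventually_nhds_in_open[of "{..<0}" u] less by (auto elim!: eventually_mono)
    from DERIV_cong_ev[OF refl this refl, of 0] show ?thesis using less by simp
  next
    case equal
    have "((\<lambda>h. max 0 h) \<longlongrightarrow> (0 :: real)) (at 0)"
      using tendsto_max[OF tendsto_const tendsto_ident_at, of 0 "0 :: real" UNIV] by simp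
    hence "((\<lambda>h. (max 0 h)\<^sup>2 / h) \<longlongrightarrow> (0 :: real)) (at 0)"
      by (rule Lim_transform_within[of _ _ _ _ 1]) (auto simp: max_def power2_eq_square)
    then show ?thesis using equal by (simp add: DERIV_def)
  next
    case greater
    have "((\<lambda>r. r\<^sup>2) has_real_derivative 2 * u) (at u)" by (auto intro!: derivative_eq_intros)
    moreover have "\<forall>\<^sub>F r in nhds u. (max 0 r)\<^sup>2 = r\<^sup>2"
      using eventually_nhds_in_open[of "{0<..}" u] greater by (auto elim!: eventually_mono)
    ultimately show ?thesis using greater DERIV_cong_ev[OF refl _ refl] by fastforce
  qed
  from DERIV_chain2[OF this assms] show ?thesis .
qed

text \<open>A solution of the Euler--Lagrange inclusion with momentum \<open>p\<close> at time \<open>0\<close> and endpoint \<open>x\<close> at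
  time \<open>t\<close>; \<open>V\<close> is its cost for the linear initial datum \<open>r \<mapsto> p r\<close>.\<close>

definition dual_extremal ::
    "(real \<Rightarrow> real) \<Rightarrow> real \<Rightarrow> real \<Rightarrow> real \<Rightarrow> (real \<Rightarrow> real) \<Rightarrow> real \<Rightarrow> bool" where
  "dual_extremal g x t p y V \<longleftrightarrow> y t = x \<and> action g t y + p * y 0 = V \<and>
    (\<exists>v w K S. (\<forall>s. (y has_real_derivative v s) (at s)) \<and> v 0 = p \<and>
       K-lipschitz_on {0..t} v \<and> finite S \<and>
       (\<forall>s\<in>{0<..<t} - S. (v has_real_derivative w s) (at s) \<and>
          (\<forall>r. g (y s) + w s * (r - y s) \<le> g r)))"

lemma dual_extremalI:
  assumes "y t = x" "action g t y + p * y 0 = V"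
    and "\<And>s. (y has_real_derivative v s) (at s)" "v 0 = p" "K-lipschitz_on {0..t} v"
    and "finite S" "\<And>s. s \<in> {0<..<t} - S \<Longrightarrow> (v has_real_derivative w s) (at s)"
    and "\<And>s r. s \<in> {0<..<t} - S \<Longrightarrow> g (y s) + w s * (r - y s) \<le> g r"
  shows "dual_extremal g x t p y V"
  unfolding dual_extremal_def using assms by blast

lemma dual_extremal_admissible:
  assumes "dual_extremal g x t p y V"
  shows "y \<in> admissible x t"
proof -
  from assms obtain v K where v: "\<And>s. (y has_real_derivative v s) (at s)" "K-lipschitz_on {0..t} v"
    and "y t = x" unfolding dual_extremal_def by blast
  moreover obtain L where "L-lipschitz_on {0..t} y"
    using DERIV_bounded_imp_lipschitz_on[OF v(1) lipschitz_on_continuous_on[OF v(2)]] by blast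
  ultimately show ?thesis by (auto simp: admissible_def)
qed

lemma dual_extremal_gap:
  assumes "dual_extremal g x t p y V" and "t > 0" and "continuous_on UNIV g"
    and "z \<in> admissible x t" and "s \<in> {0..t}"
  shows "V + (z s - y s)\<^sup>2 / (2 * t) \<le> action g t z + p * z 0"
proof -
  from assms(1) obtain v w K S where y: "y t = x" "action g t y + p * y 0 = V"
    and v: "\<And>s. (y has_real_derivative v s) (at s)" "v 0 = p" "K-lipschitz_on {0..t} v"
    and S: "finite S" "\<And>s. s \<in> {0<..<t} - S \<Longrightarrow> (v has_real_derivative w s) (at s)"
      "\<And>s r. s \<in> {0<..<t} - S \<Longrightarrow> g (y s) + w s * (r - y s) \<le> g r"
    unfolding dual_extremal_def by blast
  from assms(4) obtain L where z: "L-lipschitz_on {0..t} z" "z t = y t"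
    using y(1) by (auto simp: admissible_def)
  show ?thesis
    using action_extremal_gap[OF assms(2,3) v(1,3) S z assms(5)] v(2) y(2) by simp
qed

lemma dual_extremal_DERIV_zero:
  assumes "dual_extremal g x t p y V"
  shows "(y has_real_derivative p) (at 0)"
  using assms unfolding dual_extremal_def by metis

text \<open>The momentum is the velocity at time 0. Agreement is known on \<open>[0, t]\<close>
  only, so the velocity is read off from right difference quotients.\<close>

lemma dual_extremal_momentum_unique:
  assumes y: "dual_extremal g x t p y V" and z: "dual_extremal g x t q z W" and "t > 0"
    and eq: "\<And>s. s \<in> {0..t} \<Longrightarrow> y s = z s"
  shows "p = q"
proof -
  have "((\<lambda>s. y s - z s) has_real_derivative p - q) (at 0)"
    using y z by (intro DERIV_diff dual_extremal_DERIV_zero)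
  hence "((\<lambda>h. (y h - z h) / h) \<longlongrightarrow> p - q) (at 0)"
    using eq[of 0] \<open>t > 0\<close> by (simp add: DERIV_def)
  hence "((\<lambda>h. (y h - z h) / h) \<longlongrightarrow> p - q) (at_right 0)"
    by (rule filterlim_mono[OF _ order_refl]) (simp add: at_le)
  moreover have "\<forall>\<^sub>F h in at_right 0. (y h - z h) / h = 0"
    using eventually_at_right_less[of 0] eventually_at_right_real[OF \<open>t > 0\<close>]
    by eventually_elim (simp add: eq)
  hence "((\<lambda>h. (y h - z h) / h) \<longlongrightarrow> 0) (at_right 0)" by (rule tendsto_eventually)
  ultimately have "p - q = 0" by (rule tendsto_unique[rotated]) simp
  then show ?thesis by simp
qed

text \<open>Carries the case of nonnegative momentum over to negative momentum.\<close>

lemma dual_extremal_reflect: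
  assumes "dual_extremal g x t p y V"
  shows "dual_extremal (\<lambda>r. g (- r)) (- x) t (- p) (\<lambda>s. - y s) V"
proof -
  from assms obtain v w K S where y: "y t = x" "action g t y + p * y 0 = V"
    and v: "\<And>s. (y has_real_derivative v s) (at s)" "v 0 = p" "K-lipschitz_on {0..t} v"
    and S: "finite S" "\<And>s. s \<in> {0<..<t} - S \<Longrightarrow> (v has_real_derivative w s) (at s)"
      "\<And>s r. s \<in> {0<..<t} - S \<Longrightarrow> g (y s) + w s * (r - y s) \<le> g r"
    unfolding dual_extremal_def by blast
  have v': "((\<lambda>s. - y s) has_real_derivative - v s) (at s)" for s
    using v(1) by (rule DERIV_minus)
  have "deriv (\<lambda>s. - y s) s = - deriv y s" for s
    using DERIV_imp_deriv[OF v'] DERIV_imp_deriv[OF v(1)] by simp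
  hence "action (\<lambda>r. g (- r)) t (\<lambda>s. - y s) = action g t y" by (simp add: action_def)
  moreover have "K-lipschitz_on {0..t} (\<lambda>s. - v s)" using v(3) by (simp add: lipschitz_on_minus)
  moreover have "((\<lambda>s. - v s) has_real_derivative - w s) (at s)" if "s \<in> {0<..<t} - S" for s
    using S(2)[OF that] by (rule DERIV_minus)
  moreover have "g (- (- y s)) + - w s * (r - (- y s)) \<le> g (- r)" if "s \<in> {0<..<t} - S" for s r
    using S(3)[OF that, of "- r"] by (simp add: algebra_simps)
  ultimately show ?thesis
    using y v(2) v' S(1) by (intro dual_extremalI[where v = "\<lambda>s. - v s" and w = "\<lambda>s. - w s"]) auto
qed

text \<open>All explicit trajectories are of this form: acceleration \<open>\<alpha>\<close> before \<open>s\<^sub>1\<close>, rest (or an empty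
  interval) between \<open>s\<^sub>1\<close> and \<open>s\<^sub>2\<close>, acceleration \<open>\<beta>\<close> afterwards.\<close>

definition spline ::
    "real \<Rightarrow> real \<Rightarrow> real \<Rightarrow> real \<Rightarrow> real \<Rightarrow> real \<Rightarrow> real \<Rightarrow> real" where
  "spline \<alpha> \<beta> c m s\<^sub>1 s\<^sub>2 s =
     c + m * (s - s\<^sub>1) + \<alpha> / 2 * (max 0 (s\<^sub>1 - s))\<^sup>2 + \<beta> / 2 * (max 0 (s - s\<^sub>2))\<^sup>2"

lemma DERIV_spline:
  "(spline \<alpha> \<beta> c m s\<^sub>1 s\<^sub>2 has_real_derivative m - \<alpha> * max 0 (s\<^sub>1 - s) + \<beta> * max 0 (s - s\<^sub>2)) (at s)"
  unfolding spline_def[abs_def]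
  by (rule derivative_eq_intros DERIV_max_zero_square refl | simp)+

lemma continuous_on_potential: "continuous_on UNIV (potential a b)"
proof -
  have "potential a b = (\<lambda>r. - a * max 0 r + b * min 0 r)"
    by (auto simp: potential_def max_def min_def)
  then show ?thesis by (auto intro!: continuous_intros)
qed

text \<open>\<open>- potential a b r\<close> is the maximum of \<open>a * r\<close> and
  \<open>- b * r\<close>; the slope 0 lies between \<open>- b\<close> and \<open>a\<close>, hence
  also supports it at the origin.\<close>

lemma slope_le_potential:
  assumes "a > 0" "b > 0" "k = a \<or> k = 0 \<or> k = - b"
  shows "k * r \<le> - potential a b r"
proof -
  have "0 \<le> r \<Longrightarrow> 0 \<le> a * r" "0 \<le> r \<Longrightarrow> 0 \<le> b * r" "r < 0 \<Longrightarrow> a * r \<le> 0" "r < 0 \<Longrightarrow> b * r \<le> 0"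
    using assms by (auto simp: mult_nonneg_nonpos)
  then show ?thesis using assms(3) by (cases "0 \<le> r") (auto simp: potential_def intro: order_trans)
qed

text \<open>On an accelerated piece the integrand is a quadratic polynomial in the distance to the
  adjacent switching time, and resting at the origin costs nothing.\<close>

lemma action_spline:
  assumes s: "0 \<le> s\<^sub>1" "s\<^sub>1 \<le> s\<^sub>2" "s\<^sub>2 \<le> t"
    and rest: "s\<^sub>1 < s\<^sub>2 \<Longrightarrow> c = 0 \<and> m = 0" and "g 0 = 0"
    and left: "\<And>s. 0 < s \<Longrightarrow> s < s\<^sub>1 \<Longrightarrow> g (spline \<alpha> \<beta> c m s\<^sub>1 s\<^sub>2 s) = \<alpha> * spline \<alpha> \<beta> c m s\<^sub>1 s\<^sub>2 s"
    and right: "\<And>s. s\<^sub>2 < s \<Longrightarrow> s < t \<Longrightarrow> g (spline \<alpha> \<beta> c m s\<^sub>1 s\<^sub>2 s) = \<beta> * spline \<alpha> \<beta> c m s\<^sub>1 s\<^sub>2 s"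
  shows "action g t (spline \<alpha> \<beta> c m s\<^sub>1 s\<^sub>2) =
    (m\<^sup>2 / 2 + \<alpha> * c) * s\<^sub>1 - \<alpha> * m * s\<^sub>1\<^sup>2 + \<alpha>\<^sup>2 / 3 * s\<^sub>1 ^ 3 +
    ((m\<^sup>2 / 2 + \<beta> * c) * (t - s\<^sub>2) + \<beta> * m * (t - s\<^sub>2)\<^sup>2 + \<beta>\<^sup>2 / 3 * (t - s\<^sub>2) ^ 3)"
proof -
  let ?y = "spline \<alpha> \<beta> c m s\<^sub>1 s\<^sub>2"
  let ?f = "\<lambda>s. (deriv ?y s)\<^sup>2 / 2 + g (?y s)"
  have deriv: "deriv ?y s = m - \<alpha> * max 0 (s\<^sub>1 - s) + \<beta> * max 0 (s - s\<^sub>2)" for s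
    by (rule DERIV_imp_deriv[OF DERIV_spline])
  \<comment> \<open>Antiderivatives in the time before \<open>s\<^sub>1\<close> and after
    \<open>s\<^sub>2\<close>; the reversed time explains the minus signs in front of
    \<open>F\<close>.\<close>
  define F G where "F r = (m\<^sup>2 / 2 + \<alpha> * c) * r - \<alpha> * m * r\<^sup>2 + \<alpha>\<^sup>2 / 3 * r ^ 3"
    and "G r = (m\<^sup>2 / 2 + \<beta> * c) * r + \<beta> * m * r\<^sup>2 + \<beta>\<^sup>2 / 3 * r ^ 3" for r
  have "(?f has_integral - F (s\<^sub>1 - s\<^sub>1) - - F (s\<^sub>1 - 0)) {0..s\<^sub>1}"
  proof (rule fundamental_theorem_of_calculus_interior)
    show "continuous_on {0..s\<^sub>1} (\<lambda>s. - F (s\<^sub>1 - s))"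
      unfolding F_def by (intro continuous_intros)
    fix s assume sI: "s \<in> {0<..<s\<^sub>1}"
    have y: "?y s = c + m * (s - s\<^sub>1) + \<alpha> / 2 * (s\<^sub>1 - s)\<^sup>2"
      using sI s by (simp add: spline_def)
    have "((\<lambda>s. - F (s\<^sub>1 - s)) has_real_derivative
        (m\<^sup>2 / 2 + \<alpha> * c) - 2 * \<alpha> * m * (s\<^sub>1 - s) + \<alpha>\<^sup>2 * (s\<^sub>1 - s)\<^sup>2) (at s)"
      unfolding F_def by (auto intro!: derivative_eq_intros simp: field_simps)
    also have "(m\<^sup>2 / 2 + \<alpha> * c) - 2 * \<alpha> * m * (s\<^sub>1 - s) + \<alpha>\<^sup>2 * (s\<^sub>1 - s)\<^sup>2
        = (m - \<alpha> * (s\<^sub>1 - s))\<^sup>2 / 2 + \<alpha> * (c + m * (s - s\<^sub>1) + \<alpha> / 2 * (s\<^sub>1 - s)\<^sup>2)"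
      by (simp add: power2_eq_square field_simps)
    also have "\<dots> = ?f s"
      using left[of s] sI s by (simp add: deriv y)
    finally show "((\<lambda>s. - F (s\<^sub>1 - s)) has_vector_derivative ?f s) (at s)"
      by (simp add: has_real_derivative_iff_has_vector_derivative)
  qed (use s in auto)
  moreover have "(?f has_integral 0) {s\<^sub>1..s\<^sub>2}"
  proof (cases "s\<^sub>1 < s\<^sub>2")
    case True
    have "?f s = 0" if "s \<in> {s\<^sub>1..s\<^sub>2}" for s
      using that rest[OF True] \<open>g 0 = 0\<close> deriv[of s] by simp (simp add: spline_def)
    then show ?thesis by (intro has_integral_is_0) auto
  next
    case False
    then show ?thesis using s by (auto simp: has_integral_refl)
  qed
  moreover have "(?f has_integral G (t - s\<^sub>2) - G (s\<^sub>2 - s\<^sub>2)) {s\<^sub>2..t}"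
  proof (rule fundamental_theorem_of_calculus_interior)
    show "continuous_on {s\<^sub>2..t} (\<lambda>s. G (s - s\<^sub>2))"
      unfolding G_def by (intro continuous_intros)
    fix s assume sI: "s \<in> {s\<^sub>2<..<t}"
    have y: "?y s = c + m * (s - s\<^sub>2) + \<beta> / 2 * (s - s\<^sub>2)\<^sup>2"
      using sI s rest by (cases "s\<^sub>1 < s\<^sub>2") (auto simp: spline_def)
    have "((\<lambda>s. G (s - s\<^sub>2)) has_real_derivative
        (m\<^sup>2 / 2 + \<beta> * c) + 2 * \<beta> * m * (s - s\<^sub>2) + \<beta>\<^sup>2 * (s - s\<^sub>2)\<^sup>2) (at s)"
      unfolding G_def by (auto intro!: derivative_eq_intros simp: field_simps)
    also have "(m\<^sup>2 / 2 + \<beta> * c) + 2 * \<beta> * m * (s - s\<^sub>2) + \<beta>\<^sup>2 * (s - s\<^sub>2)\<^sup>2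
        = (m + \<beta> * (s - s\<^sub>2))\<^sup>2 / 2 + \<beta> * (c + m * (s - s\<^sub>2) + \<beta> / 2 * (s - s\<^sub>2)\<^sup>2)"
      by (simp add: power2_eq_square field_simps)
    also have "\<dots> = ?f s"
      using right[of s] sI s by (simp add: deriv y)
    finally show "((\<lambda>s. G (s - s\<^sub>2)) has_vector_derivative ?f s) (at s)"
      by (simp add: has_real_derivative_iff_has_vector_derivative)
  qed (use s in auto)
  ultimately have "(?f has_integral
      (- F (s\<^sub>1 - s\<^sub>1) - - F (s\<^sub>1 - 0)) + 0 + (G (t - s\<^sub>2) - G (s\<^sub>2 - s\<^sub>2))) {0..t}"
    using s by (intro has_integral_combine[of 0 s\<^sub>2 t] has_integral_combine[of 0 s\<^sub>1 s\<^sub>2]) auto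
  then show ?thesis
    unfolding action_def by (simp add: integral_unique F_def G_def)
qed

text \<open>Reduces each region to sign conditions on the accelerated pieces and to algebraic
  identities for momentum, endpoint and value.\<close>

lemma dual_extremal_spline:
  fixes a b :: real
  defines "g \<equiv> \<lambda>r. - potential a b r"
  assumes ab: "a > 0" "b > 0"
    and s: "0 \<le> s\<^sub>1" "s\<^sub>1 \<le> s\<^sub>2" "s\<^sub>2 \<le> t" and "t > 0"
    and \<alpha>: "\<alpha> = a \<or> \<alpha> = - b" and \<beta>: "\<beta> = a \<or> \<beta> = - b"
    and p: "p = m - \<alpha> * s\<^sub>1"
    and rest: "s\<^sub>1 < s\<^sub>2 \<Longrightarrow> c = 0 \<and> m = 0"
    and left: "\<And>s. 0 < s \<Longrightarrow> s < s\<^sub>1 \<Longrightarrow> g (spline \<alpha> \<beta> c m s\<^sub>1 s\<^sub>2 s) = \<alpha> * spline \<alpha> \<beta> c m s\<^sub>1 s\<^sub>2 s"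
    and right: "\<And>s. s\<^sub>2 < s \<Longrightarrow> s < t \<Longrightarrow> g (spline \<alpha> \<beta> c m s\<^sub>1 s\<^sub>2 s) = \<beta> * spline \<alpha> \<beta> c m s\<^sub>1 s\<^sub>2 s"
    and x: "x = c + m * (t - s\<^sub>1) + \<beta> / 2 * (t - s\<^sub>2)\<^sup>2"
    and V: "V = (m\<^sup>2 / 2 + \<alpha> * c) * s\<^sub>1 - \<alpha> * m * s\<^sub>1\<^sup>2 + \<alpha>\<^sup>2 / 3 * s\<^sub>1 ^ 3 +
      ((m\<^sup>2 / 2 + \<beta> * c) * (t - s\<^sub>2) + \<beta> * m * (t - s\<^sub>2)\<^sup>2 + \<beta>\<^sup>2 / 3 * (t - s\<^sub>2) ^ 3) +
      p * (c - m * s\<^sub>1 + \<alpha> / 2 * s\<^sub>1\<^sup>2)"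
  shows "dual_extremal g x t p (spline \<alpha> \<beta> c m s\<^sub>1 s\<^sub>2) V"
proof -
  let ?y = "spline \<alpha> \<beta> c m s\<^sub>1 s\<^sub>2"
  define v where "v s = m - \<alpha> * max 0 (s\<^sub>1 - s) + \<beta> * max 0 (s - s\<^sub>2)" for s
  define w where "w s = (if s < s\<^sub>1 then \<alpha> else if s < s\<^sub>2 then 0 else \<beta>)" for s
  have "?y t = x" using s x by (simp add: spline_def)
  moreover have "action g t ?y + p * ?y 0 = V"
    using action_spline[OF s rest _ left right] s V
    by (simp add: g_def potential_def) (simp add: spline_def)
  moreover have "(?y has_real_derivative v s) (at s)" for s
    unfolding v_def by (rule DERIV_spline)
  moreover have "v 0 = p" using s p by (simp add: v_def)
  moreover have "(\<bar>\<alpha>\<bar> + \<bar>\<beta>\<bar>)-lipschitz_on {0..t} v"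
  proof (rule lipschitz_onI)
    fix r s :: real
    have "v r - v s = \<alpha> * (max 0 (s\<^sub>1 - s) - max 0 (s\<^sub>1 - r)) + \<beta> * (max 0 (r - s\<^sub>2) - max 0 (s - s\<^sub>2))"
      by (simp add: v_def algebra_simps)
    also have "\<bar>\<dots>\<bar> \<le> \<bar>\<alpha>\<bar> * \<bar>max 0 (s\<^sub>1 - s) - max 0 (s\<^sub>1 - r)\<bar> + \<bar>\<beta>\<bar> * \<bar>max 0 (r - s\<^sub>2) - max 0 (s - s\<^sub>2)\<bar>"
      by (metis abs_mult abs_triangle_ineq)
    also have "\<dots> \<le> \<bar>\<alpha>\<bar> * \<bar>r - s\<bar> + \<bar>\<beta>\<bar> * \<bar>r - s\<bar>"
      by (intro add_mono mult_left_mono) auto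
    finally show "dist (v r) (v s) \<le> (\<bar>\<alpha>\<bar> + \<bar>\<beta>\<bar>) * dist r s"
      by (simp add: dist_real_def distrib_right)
  qed simp
  moreover have "(v has_real_derivative w s) (at s)" if sI: "s \<in> {0<..<t} - {s\<^sub>1, s\<^sub>2}" for s
  proof -
    consider "s < s\<^sub>1" | "s\<^sub>1 < s" "s < s\<^sub>2" | "s\<^sub>2 < s" using sI by (metis DiffD2 insertI1 insertI2 linorder_less_linear)
    then show ?thesis
    proof cases
      case 1
      have "((\<lambda>s. m - \<alpha> * (s\<^sub>1 - s)) has_real_derivative w s) (at s)"
        using 1 by (auto simp: w_def intro!: derivative_eq_intros)
      moreover have "\<forall>\<^sub>F r in nhds s. v r = m - \<alpha> * (s\<^sub>1 - r)"
        using eventually_nhds_in_open[of "{..<s\<^sub>1}" s] 1 s by (auto simp: v_def elim!: eventually_mono)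
      ultimately show ?thesis by (simp cong: DERIV_cong_ev)
    next
      case 2
      have "\<forall>\<^sub>F r in nhds s. v r = m"
        using eventually_nhds_in_open[of "{s\<^sub>1<..<s\<^sub>2}" s] 2 by (auto simp: v_def elim!: eventually_mono)
      then show ?thesis using 2 by (simp add: w_def cong: DERIV_cong_ev)
    next
      case 3
      have "((\<lambda>s. m + \<beta> * (s - s\<^sub>2)) has_real_derivative w s) (at s)"
        using 3 s by (auto simp: w_def intro!: derivative_eq_intros)
      moreover have "\<forall>\<^sub>F r in nhds s. v r = m + \<beta> * (r - s\<^sub>2)"
        using eventually_nhds_in_open[of "{s\<^sub>2<..}" s] 3 s by (auto simp: v_def elim!: eventually_mono)
      ultimately show ?thesis by (simp cong: DERIV_cong_ev)
    qed
  qed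
  moreover have "g (?y s) + w s * (r - ?y s) \<le> g r" if sI: "s \<in> {0<..<t} - {s\<^sub>1, s\<^sub>2}" for s r
  proof -
    consider "s < s\<^sub>1" | "s\<^sub>1 < s" "s < s\<^sub>2" | "s\<^sub>2 < s" using sI by (metis DiffD2 insertI1 insertI2 linorder_less_linear)
    \<comment> \<open>Since \<open>g\<close> is positively homogeneous, its supporting lines pass
      through the origin; only \<open>w s * r \<le> g r\<close> then remains.\<close>
    hence "g (?y s) = w s * ?y s"
    proof cases
      case 2
      hence "c = 0" "m = 0" using rest by auto
      with 2 show ?thesis by (simp add: w_def g_def spline_def potential_def)
    qed (use sI s left right in \<open>auto simp: w_def\<close>)
    moreover have "w s * r \<le> g r"
      unfolding g_def using \<alpha> \<beta> by (intro slope_le_potential ab) (auto simp: w_def)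
    ultimately show ?thesis by (simp add: algebra_simps)
  qed
  ultimately show ?thesis
    by (intro dual_extremalI[where v = v and w = w and S = "{s\<^sub>1, s\<^sub>2}"]) simp_all
qed

section \<open>The explicit trajectories\<close>

lemma powr_three_halves:
  assumes "0 \<le> u"
  shows "u powr (3 / 2) = sqrt u ^ 3"
proof -
  have "u powr (3 / 2) = (u powr (1 / 2)) powr 3" by (simp add: powr_powr)
  also have "\<dots> = sqrt u powr 3" using assms by (simp add: powr_half_sqrt)
  also have "\<dots> = sqrt u ^ 3" using assms by (cases "u = 0") (simp_all add: powr_numeral)
  finally show ?thesis .
qed

lemma minus_potential_nonneg: "0 \<le> r \<Longrightarrow> - potential a b r = a * r"
  and minus_potential_nonpos: "r \<le> 0 \<Longrightarrow> - potential a b r = - b * r"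
  by (auto simp: potential_def)

lemma max_zero_squares: "(max 0 (- s))\<^sup>2 + (max 0 s)\<^sup>2 = s\<^sup>2" for s :: real
  by (simp add: max_def)

text \<open>With both switches at 0 the truncated squares merge into one parabola, the form needed
  in regions 1 and 2.\<close>

lemma spline_same_curvature:
  "spline \<alpha> \<alpha> c m 0 0 = (\<lambda>s. c + m * s + \<alpha> / 2 * s\<^sup>2)"
proof
  fix s
  have "spline \<alpha> \<alpha> c m 0 0 s = c + m * s + \<alpha> / 2 * ((max 0 (- s))\<^sup>2 + (max 0 s)\<^sup>2)"
    by (simp add: spline_def distrib_left)
  then show "spline \<alpha> \<alpha> c m 0 0 s = c + m * s + \<alpha> / 2 * s\<^sup>2" by (simp only: max_zero_squares)
qed

text \<open>The curve starts at \<open>c \<ge> 0\<close> with velocity \<open>p \<ge> 0\<close> and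
  acceleration \<open>a\<close>, so it never becomes negative.\<close>

lemma dual_extremal_Omega1:
  assumes ab: "a > 0" "b > 0" and t: "t > 0" and "(x, t, p) \<in> Omega1 a b"
  shows "dual_extremal (\<lambda>r. - potential a b r) x t p
    (\<lambda>s. x - p * (t - s) - a / 2 * (t\<^sup>2 - s\<^sup>2)) (f1 x t p a b)"
proof -
  define c where "c = x - p * t - a / 2 * t\<^sup>2"
  have p: "0 \<le> p" and c: "0 \<le> c" using assms(4) by (auto simp: Omega1_def c_def)
  have eq: "spline a a c p 0 0 = (\<lambda>s. x - p * (t - s) - a / 2 * (t\<^sup>2 - s\<^sup>2))"
    by (auto simp: spline_same_curvature c_def field_simps)
  have "dual_extremal (\<lambda>r. - potential a b r) x t p (spline a a c p 0 0) (f1 x t p a b)"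
  proof (rule dual_extremal_spline[OF ab])
    fix s assume "0 < s" "s < t"
    hence "0 \<le> spline a a c p 0 0 s" using p c ab by (simp add: spline_same_curvature)
    then show "- potential a b (spline a a c p 0 0 s) = a * spline a a c p 0 0 s"
      by (rule minus_potential_nonneg)
  qed (use t in \<open>auto simp: c_def f1_def power2_eq_square power3_eq_cube field_simps\<close>)
  then show ?thesis by (simp only: eq)
qed

lemma dual_extremal_Omega2:
  assumes ab: "a > 0" "b > 0" and t: "t > 0" and \<Omega>: "(x, t, p) \<in> Omega2 a b"
  shows "dual_extremal (\<lambda>r. - potential a b r) x t p
    (\<lambda>s. x - p * (t - s) + b / 2 * (t\<^sup>2 - s\<^sup>2)) (f2 x t p a b)"
proof -
  define c where "c = x - p * t + b / 2 * t\<^sup>2"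
  have eq: "spline (- b) (- b) c p 0 0 = (\<lambda>s. x - p * (t - s) + b / 2 * (t\<^sup>2 - s\<^sup>2))"
    by (auto simp: spline_same_curvature c_def field_simps)
  have neg: "x - p * (t - s) + b / 2 * (t\<^sup>2 - s\<^sup>2) \<le> 0" if s: "0 < s" "s < t" for s
  \<comment> \<open>If \<open>t < p / b\<close>, the curve increases up to its endpoint
    \<open>x < 0\<close>; otherwise its apex, at time \<open>p / b\<close>, has the height
    controlled by the second clause of \<open>Omega2\<close>.\<close>
  proof (cases "t < p / b")
    case True
    hence "x < 0" "b * t < p" using \<Omega> ab by (auto simp: Omega2_def field_simps)
    moreover have "b * (t + s) \<le> b * (2 * t)" using s ab by (intro mult_left_mono) auto
    ultimately have "(t - s) * (b / 2 * (t + s) - p) \<le> 0"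
      using s by (intro mult_nonneg_nonpos) (auto simp: field_simps)
    moreover have "x - p * (t - s) + b / 2 * (t\<^sup>2 - s\<^sup>2) = x + (t - s) * (b / 2 * (t + s) - p)"
      by (simp add: power2_eq_square field_simps)
    ultimately show ?thesis using \<open>x < 0\<close> by linarith
  next
    case False
    hence "x + b / 2 * (t - p / b)\<^sup>2 \<le> 0" using \<Omega> by (auto simp: Omega2_def)
    moreover have "0 \<le> b / 2 * (s - p / b)\<^sup>2" using ab by simp
    moreover have "x - p * (t - s) + b / 2 * (t\<^sup>2 - s\<^sup>2)
        = x + b / 2 * (t - p / b)\<^sup>2 - b / 2 * (s - p / b)\<^sup>2"
      using ab by (simp add: power2_eq_square field_simps)
    ultimately show ?thesis by linarith
  qed
  have "dual_extremal (\<lambda>r. - potential a b r) x t p (spline (- b) (- b) c p 0 0) (f2 x t p a b)"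
  proof (rule dual_extremal_spline[OF ab])
    fix s assume "0 < s" "s < t"
    hence "spline (- b) (- b) c p 0 0 s \<le> 0" unfolding eq by (rule neg)
    then show "- potential a b (spline (- b) (- b) c p 0 0 s) = - b * spline (- b) (- b) c p 0 0 s"
      by (rule minus_potential_nonpos)
  qed (use t in \<open>auto simp: c_def f2_def power2_eq_square power3_eq_cube field_simps\<close>)
  then show ?thesis by (simp only: eq)
qed

text \<open>Here \<open>m\<close> is the velocity at the time \<open>\<tau>\<close> at which the trajectory crosses the origin.\<close>

lemma Omega3_switching:
  fixes a b t x p :: real
  defines "\<tau> \<equiv> tau x t p a b" and "m \<equiv> p - b * tau x t p a b" and "T \<equiv> t - tau x t p a b"
  assumes ab: "a > 0" "b > 0" and \<Omega>: "(x, t, p) \<in> Omega3 a b"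
  shows "0 \<le> \<tau>" "0 \<le> T" "0 \<le> m" "x = m * T + a / 2 * T\<^sup>2"
    and "sqrt ((b * t - p)\<^sup>2 + 2 * x * (a + 2 * b)) = (a + b) * T + m"
    and "0 \<le> (b * t - p)\<^sup>2 + 2 * x * (a + 2 * b)"
proof -
  define k where "k = a + 2 * b"
  \<comment> \<open>After multiplication by \<open>k\<close>, the quantities \<open>\<tau>\<close>,
    \<open>T\<close> and \<open>m\<close> are linear in the root \<open>r\<close>, so each sign
    claim becomes a bound on \<open>r\<close>.\<close>
  define r where "r = sqrt ((b * t - p)\<^sup>2 + 2 * x * k)"
  have k: "k > 0" using ab by (simp add: k_def)
  have \<tau>: "k * \<tau> = (a + b) * t + p - r"
    using k unfolding \<tau>_def tau_def r_def k_def by (simp add: field_simps)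
  have T: "k * T = b * t - p + r" using \<tau> unfolding T_def \<tau>_def[symmetric] k_def by (simp add: algebra_simps)
  have m: "k * m = b * r - (a + b) * (b * t - p)"
  proof -
    have "k * m = k * p - b * (k * \<tau>)" by (simp add: m_def \<tau>_def algebra_simps)
    then show ?thesis by (simp add: \<tau>) (simp add: k_def algebra_simps)
  qed
  have tp: "0 \<le> t" "0 \<le> p" and xup: "x \<le> p * t + a / 2 * t\<^sup>2" and x0: "0 \<le> x"
    and x: "t < p / b \<or> a / 2 * (t - p / b)\<^sup>2 \<le> x"
  proof -
    have "0 \<le> a / 2 * (t - p / b)\<^sup>2" using ab by simp
    then show "0 \<le> x" using \<Omega> by (auto simp: Omega3_def)
  qed (use \<Omega> in \<open>auto simp: Omega3_def\<close>)
  show nn: "0 \<le> (b * t - p)\<^sup>2 + 2 * x * (a + 2 * b)" using x0 ab by simp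
  have r0: "0 \<le> r" and r2: "r\<^sup>2 = (b * t - p)\<^sup>2 + 2 * x * k" using nn by (auto simp: r_def k_def)
  show "0 \<le> \<tau>"
  proof -
    have "x * k \<le> (p * t + a / 2 * t\<^sup>2) * k" using xup k by (intro mult_right_mono) auto
    hence "r\<^sup>2 \<le> (b * t - p)\<^sup>2 + 2 * ((p * t + a / 2 * t\<^sup>2) * k)" using r2 by simp
    \<comment> \<open>At the upper boundary of \<open>Omega3\<close> the radicand is a perfect
      square.\<close>
    also have "\<dots> = ((a + b) * t + p)\<^sup>2" by (simp add: k_def power2_eq_square algebra_simps)
    finally have "r \<le> (a + b) * t + p" by (rule power2_le_imp_le) (use tp ab in simp)
    hence "0 \<le> k * \<tau>" using \<tau> by simp
    then show ?thesis using k by (simp add: zero_le_mult_iff)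
  qed
  have "\<bar>b * t - p\<bar> \<le> \<bar>r\<bar>" using r2 x0 k by (simp add: abs_le_square_iff)
  hence rabs: "\<bar>b * t - p\<bar> \<le> r" using r0 by simp
  show T0: "0 \<le> T"
  proof -
    have "0 \<le> k * T" using T rabs by simp
    then show ?thesis using k by (simp add: zero_le_mult_iff)
  qed
  show m0: "0 \<le> m"
  proof -
    \<comment> \<open>For \<open>t \<ge> p / b\<close> the squared form of this bound is the lower
      boundary of \<open>Omega3\<close>.\<close>
    have "(a + b) * (b * t - p) \<le> b * r"
    proof (cases "t < p / b")
      case True
      hence "b * t - p \<le> 0" using ab by (simp add: field_simps)
      hence "(a + b) * (b * t - p) \<le> 0" using ab by (intro mult_nonneg_nonpos) auto
      also have "0 \<le> b * r" using ab r0 by simp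
      finally show ?thesis .
    next
      case False
      hence "a / 2 * (t - p / b)\<^sup>2 \<le> x" using x by simp
      hence "b\<^sup>2 * (a / 2 * (t - p / b)\<^sup>2) \<le> b\<^sup>2 * x" by (intro mult_left_mono) auto
      also have "b\<^sup>2 * (a / 2 * (t - p / b)\<^sup>2) = a / 2 * (b * t - p)\<^sup>2"
        using ab by (simp add: power2_eq_square field_simps)
      finally have bound: "a / 2 * (b * t - p)\<^sup>2 * (2 * k) \<le> b\<^sup>2 * x * (2 * k)"
        using k by (intro mult_right_mono) auto
      have "((a + b) * (b * t - p))\<^sup>2 \<le> (b * r)\<^sup>2"
      proof -
        have "((a + b) * (b * t - p))\<^sup>2 = b\<^sup>2 * (b * t - p)\<^sup>2 + a / 2 * (b * t - p)\<^sup>2 * (2 * k)"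
          unfolding power_mult_distrib by (simp add: k_def power2_sum algebra_simps) (simp add: power2_eq_square)
        moreover have "(b * r)\<^sup>2 = b\<^sup>2 * (b * t - p)\<^sup>2 + b\<^sup>2 * x * (2 * k)"
          unfolding power_mult_distrib r2 by (simp add: algebra_simps)
        ultimately show ?thesis
          using bound by linarith
      qed
      then show ?thesis by (rule power2_le_imp_le) (use ab r0 in simp)
    qed
    hence "0 \<le> k * m" using m by simp
    then show ?thesis using k by (simp add: zero_le_mult_iff)
  qed
  \<comment> \<open>This removes the square root: in terms of the crossing data \<open>f3\<close>
    becomes a polynomial.\<close>
  have r: "r = (a + b) * T + m"
  proof -
    have "k * ((a + b) * T + m) = (a + b) * (k * T) + k * m" by (simp add: algebra_simps)
    also have "\<dots> = k * r" unfolding T m by (simp add: k_def algebra_simps)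
    finally show ?thesis using k by simp
  qed
  then show "sqrt ((b * t - p)\<^sup>2 + 2 * x * (a + 2 * b)) = (a + b) * T + m"
    by (simp add: r_def k_def)
  have "b * t - p = b * T - m" by (simp add: T_def m_def algebra_simps)
  hence "2 * x * k = ((a + b) * T + m)\<^sup>2 - (b * T - m)\<^sup>2" using r2 unfolding r by simp
  also have "\<dots> = 2 * (m * T + a / 2 * T\<^sup>2) * k" by (simp add: k_def power2_eq_square algebra_simps)
  finally show "x = m * T + a / 2 * T\<^sup>2" using k by simp
qed

text \<open>Crossing the origin with velocity \<open>m \<ge> 0\<close> keeps the curve nonpositive
  before \<open>\<tau>\<close> and nonnegative afterwards.\<close>

lemma dual_extremal_Omega3:
  assumes ab: "a > 0" "b > 0" and t: "t > 0" and \<Omega>: "(x, t, p) \<in> Omega3 a b"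
  shows "dual_extremal (\<lambda>r. - potential a b r) x t p
    (\<lambda>s. let \<tau> = tau x t p a b in
        if s < \<tau> then - p * (\<tau> - s) + b / 2 * (\<tau>\<^sup>2 - s\<^sup>2)
        else (p - b * \<tau>) * (s - \<tau>) + a / 2 * (s - \<tau>)\<^sup>2) (f3 x t p a b)"
proof -
  define \<tau> m T where "\<tau> = tau x t p a b" and "m = p - b * tau x t p a b" and "T = t - tau x t p a b"
  note sw = Omega3_switching[OF ab \<Omega>, folded \<tau>_def m_def T_def]
  have tT: "t = \<tau> + T" and pm: "p = m + b * \<tau>" by (auto simp: \<tau>_def m_def T_def)
  let ?y = "spline (- b) a 0 m \<tau> \<tau>"
  have eq: "(\<lambda>s. let \<tau> = tau x t p a b in
        if s < \<tau> then - p * (\<tau> - s) + b / 2 * (\<tau>\<^sup>2 - s\<^sup>2)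
        else (p - b * \<tau>) * (s - \<tau>) + a / 2 * (s - \<tau>)\<^sup>2) = ?y"
    unfolding \<tau>_def[symmetric] Let_def
    by (auto simp: spline_def pm power2_eq_square field_simps)
  have "dual_extremal (\<lambda>r. - potential a b r) x t p ?y (f3 x t p a b)"
  proof (rule dual_extremal_spline[OF ab])
    fix s assume "0 < s" "s < \<tau>"
    hence "m * (s - \<tau>) \<le> 0" using sw(3) by (intro mult_nonneg_nonpos) auto
    moreover have "0 \<le> b / 2 * (\<tau> - s)\<^sup>2" using ab by simp
    moreover have "?y s = m * (s - \<tau>) - b / 2 * (\<tau> - s)\<^sup>2"
      using \<open>s < \<tau>\<close> by (simp add: spline_def)
    ultimately have "?y s \<le> 0" by linarith
    then show "- potential a b (?y s) = - b * ?y s" by (rule minus_potential_nonpos)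
  next
    fix s assume "\<tau> < s" "s < t"
    hence "0 \<le> ?y s" using sw(3) ab by (simp add: spline_def)
    then show "- potential a b (?y s) = a * ?y s" by (rule minus_potential_nonneg)
  next
    show "x = 0 + m * (t - \<tau>) + a / 2 * (t - \<tau>)\<^sup>2" using sw(4) tT by simp
    define k where "k = a + 2 * b"
    have k: "k > 0" using ab by (simp add: k_def)
    \<comment> \<open>\<open>Q\<close> is the cost in the crossing data, \<open>R\<close> collects
      the summands of \<open>f3\<close> without \<open>x\<close>, and \<open>N\<close> is the
      bracket in \<open>f3\<close> once the root is replaced.\<close>
    define Q where "Q = m\<^sup>2 / 2 * \<tau> + b * m * \<tau>\<^sup>2 + b\<^sup>2 / 3 * \<tau> ^ 3 +
      (m\<^sup>2 / 2 * T + a * m * T\<^sup>2 + a\<^sup>2 / 3 * T ^ 3) + p * (- m * \<tau> - b / 2 * \<tau>\<^sup>2)"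
    define R where "R = - (b\<^sup>2 / 6) * t ^ 3 + b / 2 * p * t\<^sup>2 - 1 / 2 * p\<^sup>2 * t"
    define N where "N = (b * T - m) ^ 3 + ((a + b) * T + m) ^ 3"
    have "(a + b) * N - 3 * k * b * (b * T - m) * x = 3 * k\<^sup>2 * (Q - R)"
      unfolding N_def Q_def R_def sw(4) tT pm k_def
      by (simp add: power2_eq_square power3_eq_cube field_simps)
    moreover have "(a + b) / (3 * k\<^sup>2) * N - b / k * (b * T - m) * x
        = ((a + b) * N - 3 * k * b * (b * T - m) * x) / (3 * k\<^sup>2)"
      using k by (simp add: power2_eq_square diff_divide_distrib)
    ultimately have "(a + b) / (3 * k\<^sup>2) * N - b / k * (b * T - m) * x = Q - R"
      using k by simp
    moreover have "b * t - p = b * T - m" unfolding tT pm by (simp add: algebra_simps)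
    ultimately have "f3 x t p a b = Q"
      unfolding f3_def powr_three_halves[OF sw(6)] sw(5) by (simp add: N_def k_def R_def)
    then show "f3 x t p a b = (m\<^sup>2 / 2 + - b * 0) * \<tau> - - b * m * \<tau>\<^sup>2 + (- b)\<^sup>2 / 3 * \<tau> ^ 3 +
      ((m\<^sup>2 / 2 + a * 0) * (t - \<tau>) + a * m * (t - \<tau>)\<^sup>2 + a\<^sup>2 / 3 * (t - \<tau>) ^ 3) +
      p * (0 - m * \<tau> + - b / 2 * \<tau>\<^sup>2)"
      by (simp add: Q_def tT)
  qed (use sw t pm tT in auto)
  then show ?thesis by (simp only: eq)
qed

text \<open>The curve comes to rest at the origin at time \<open>p / b\<close>, waits, and leaves at
  \<open>t - T\<close>, where \<open>T\<close> is the time needed to reach \<open>x\<close> from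
  rest with acceleration \<open>a\<close>.\<close>

lemma dual_extremal_Omega4:
  assumes ab: "a > 0" "b > 0" and t: "t > 0" and \<Omega>: "(x, t, p) \<in> Omega4 a b"
  shows "dual_extremal (\<lambda>r. - potential a b r) x t p
    (\<lambda>s. if s < p / b then - (1 / (2 * b)) * (p - b * s)\<^sup>2
        else if s < t - sqrt (2 * x / a) then 0
        else a / 2 * (s - t + sqrt (2 * x / a))\<^sup>2) (f4 x t p a b)"
proof -
  define T where "T = sqrt (2 * x / a)"
  have x: "0 \<le> x" "x < a / 2 * (t - p / b)\<^sup>2" and tp: "p / b \<le> t" "0 \<le> p"
    using \<Omega> by (auto simp: Omega4_def)
  have T: "0 \<le> T" "T\<^sup>2 = 2 * x / a" using x ab by (auto simp: T_def)
  have "T\<^sup>2 \<le> (t - p / b)\<^sup>2" using x ab unfolding T(2) by (simp add: field_simps)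
  \<comment> \<open>The upper bound on \<open>x\<close> in \<open>Omega4\<close> thus means that
    departure does not precede arrival.\<close>
  hence Tt: "T \<le> t - p / b" by (rule power2_le_imp_le) (use tp in simp)
  let ?y = "spline (- b) a 0 0 (p / b) (t - T)"
  have eq: "(\<lambda>s. if s < p / b then - (1 / (2 * b)) * (p - b * s)\<^sup>2
        else if s < t - sqrt (2 * x / a) then 0
        else a / 2 * (s - t + sqrt (2 * x / a))\<^sup>2) = ?y"
  proof
    fix s
    have left: "- (1 / (2 * b)) * (p - b * s)\<^sup>2 = - b / 2 * (max 0 (p / b - s))\<^sup>2" if "s < p / b"
      using that ab by (simp add: power2_eq_square field_simps)
    have right: "s - t + T = max 0 (s - (t - T))" if "\<not> s < t - T" using that by simp
    show "(if s < p / b then - (1 / (2 * b)) * (p - b * s)\<^sup>2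
        else if s < t - sqrt (2 * x / a) then 0
        else a / 2 * (s - t + sqrt (2 * x / a))\<^sup>2) = ?y s"
      unfolding T_def[symmetric] using Tt left right by (simp add: spline_def)
  qed
  have "dual_extremal (\<lambda>r. - potential a b r) x t p ?y (f4 x t p a b)"
  proof (rule dual_extremal_spline[OF ab])
    fix s assume "0 < s" "s < p / b"
    hence "?y s \<le> 0" using Tt ab by (simp add: spline_def)
    then show "- potential a b (?y s) = - b * ?y s" by (rule minus_potential_nonpos)
  next
    fix s assume "t - T < s" "s < t"
    hence "0 \<le> ?y s" using Tt ab by (simp add: spline_def)
    then show "- potential a b (?y s) = a * ?y s" by (rule minus_potential_nonneg)
  next
    show "x = 0 + 0 * (t - p / b) + a / 2 * (t - (t - T))\<^sup>2" using T ab by simp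
    have "(2 * x / a) powr (3 / 2) = T ^ 3" unfolding T_def using x ab by (intro powr_three_halves) simp
    then show "f4 x t p a b = (0\<^sup>2 / 2 + - b * 0) * (p / b) - - b * 0 * (p / b)\<^sup>2 + (- b)\<^sup>2 / 3 * (p / b) ^ 3 +
      ((0\<^sup>2 / 2 + a * 0) * (t - (t - T)) + a * 0 * (t - (t - T))\<^sup>2 + a\<^sup>2 / 3 * (t - (t - T)) ^ 3) +
      p * (0 - 0 * (p / b) + - b / 2 * (p / b)\<^sup>2)"
      using ab by (simp add: f4_def power2_eq_square power3_eq_cube field_simps)
  qed (use T Tt t tp ab in auto)
  then show ?thesis by (simp only: eq)
qed

text \<open>As in region 4, but the curve leaves the origin downwards: both accelerated pieces have
  curvature \<open>- b\<close>, and the curve is nowhere positive.\<close>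

lemma dual_extremal_Omega5:
  assumes ab: "a > 0" "b > 0" and t: "t > 0" and \<Omega>: "(x, t, p) \<in> Omega5 a b"
  shows "dual_extremal (\<lambda>r. - potential a b r) x t p
    (\<lambda>s. if s < p / b then - (1 / (2 * b)) * (p - b * s)\<^sup>2
        else if s < t - sqrt (2 * \<bar>x\<bar> / b) then 0
        else - (b / 2) * (s - t + sqrt (2 * \<bar>x\<bar> / b))\<^sup>2) (f5 x t p a b)"
proof -
  define T where "T = sqrt (2 * \<bar>x\<bar> / b)"
  have x: "x < 0" "\<bar>x\<bar> \<le> b / 2 * (t - p / b)\<^sup>2" and tp: "p / b \<le> t" "0 \<le> p"
    using \<Omega> by (auto simp: Omega5_def)
  have "0 \<le> 2 * \<bar>x\<bar> / b" using ab by simp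
  hence T: "0 \<le> T" "T\<^sup>2 = 2 * \<bar>x\<bar> / b" by (simp_all only: T_def real_sqrt_ge_zero real_sqrt_pow2)
  have "T\<^sup>2 \<le> (t - p / b)\<^sup>2" using x ab unfolding T(2) by (simp add: field_simps)
  hence Tt: "T \<le> t - p / b" by (rule power2_le_imp_le) (use tp in simp)
  let ?y = "spline (- b) (- b) 0 0 (p / b) (t - T)"
  have eq: "(\<lambda>s. if s < p / b then - (1 / (2 * b)) * (p - b * s)\<^sup>2
        else if s < t - sqrt (2 * \<bar>x\<bar> / b) then 0
        else - (b / 2) * (s - t + sqrt (2 * \<bar>x\<bar> / b))\<^sup>2) = ?y"
  proof
    fix s
    have left: "- (1 / (2 * b)) * (p - b * s)\<^sup>2 = - b / 2 * (max 0 (p / b - s))\<^sup>2" if "s < p / b"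
      using that ab by (simp add: power2_eq_square field_simps)
    have right: "s - t + T = max 0 (s - (t - T))" if "\<not> s < t - T" using that by simp
    show "(if s < p / b then - (1 / (2 * b)) * (p - b * s)\<^sup>2
        else if s < t - sqrt (2 * \<bar>x\<bar> / b) then 0
        else - (b / 2) * (s - t + sqrt (2 * \<bar>x\<bar> / b))\<^sup>2) = ?y s"
      unfolding T_def[symmetric] using Tt left right by (simp add: spline_def)
  qed
  have neg: "?y s \<le> 0" for s
  proof -
    have "0 \<le> b / 2 * (max 0 (p / b - s))\<^sup>2" "0 \<le> b / 2 * (max 0 (s - (t - T)))\<^sup>2"
      using ab by simp_all
    then show ?thesis by (simp add: spline_def)
  qed
  have "dual_extremal (\<lambda>r. - potential a b r) x t p ?y (f5 x t p a b)"
  proof (rule dual_extremal_spline[OF ab])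
    show "- potential a b (?y s) = - b * ?y s" "- potential a b (?y s) = - b * ?y s" for s
      using neg by (rule minus_potential_nonpos)+
    show "x = 0 + 0 * (t - p / b) + - b / 2 * (t - (t - T))\<^sup>2" using T x ab by simp
    have "(- 2 * x / b) powr (3 / 2) = T ^ 3"
      unfolding T_def using x ab powr_three_halves[of "- 2 * x / b"] by (simp add: divide_nonpos_pos)
    then show "f5 x t p a b = (0\<^sup>2 / 2 + - b * 0) * (p / b) - - b * 0 * (p / b)\<^sup>2 + (- b)\<^sup>2 / 3 * (p / b) ^ 3 +
      ((0\<^sup>2 / 2 + - b * 0) * (t - (t - T)) + - b * 0 * (t - (t - T))\<^sup>2 + (- b)\<^sup>2 / 3 * (t - (t - T)) ^ 3) +
      p * (0 - 0 * (p / b) + - b / 2 * (p / b)\<^sup>2)"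
      using ab by (simp add: f5_def power2_eq_square power3_eq_cube field_simps)
  qed (use T Tt t tp ab in auto)
  then show ?thesis by (simp only: eq)
qed

section \<open>Assembly of the regions and application to the control problem\<close>

lemma dual_extremal_gamma_nonneg:
  assumes ab: "a > 0" "b > 0" and t: "t > 0" and "p \<ge> 0"
  shows "dual_extremal (\<lambda>r. - potential a b r) x t p
    (\<lambda>s. gamma_nonneg s x t p a b) (V_nonneg x t p a b)"
proof -
  have "(x, t, p) \<in> Omega1 a b \<union> Omega2 a b \<union> Omega3 a b \<union> Omega4 a b \<union> Omega5 a b"
    unfolding Omega_cover[OF ab] using t \<open>p \<ge> 0\<close> by simp
  then show ?thesis
    using dual_extremal_Omega1[OF ab t] dual_extremal_Omega2[OF ab t] dual_extremal_Omega3[OF ab t]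
      dual_extremal_Omega4[OF ab t] dual_extremal_Omega5[OF ab t]
    unfolding gamma_nonneg_def V_nonneg_def by (simp split: if_split) blast
qed

lemma dual_extremal_gamma_explicit:
  assumes ab: "a > 0" "b > 0" and t: "t > 0"
  shows "dual_extremal (\<lambda>r. - potential a b r) x t p
    (\<lambda>s. gamma_explicit s x t p a b) (V_explicit x t p a b)"
proof (cases "p \<ge> 0")
  case True
  then show ?thesis
    using dual_extremal_gamma_nonneg[OF assms] by (simp add: gamma_explicit_def V_explicit_def)
next
  case False
  \<comment> \<open>Reflection exchanges \<open>a\<close> and \<open>b\<close>, matching the
    exchanged parameters in the explicit formulas for negative \<open>p\<close>.\<close>
  have "potential b a (- r) = potential a b r" for r by (auto simp: potential_def)
  then show ?thesis
    using dual_extremal_reflect[OF dual_extremal_gamma_nonneg[OF ab(2,1) t, of "- p" "- x"]] False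
    by (simp add: gamma_explicit_def V_explicit_def)
qed

theorem proposition2p2:
  fixes a b x t :: real and \<Phi> :: "real \<Rightarrow> real"
  assumes "a > 0" and "b > 0"
    and "convex_on UNIV \<Phi>"
    and "growth_cond \<Phi>"
    and "t > 0"
  shows "(\<exists>!p. is_maximizer \<Phi> a b x t p) \<and>
    optimal_trajectory \<Phi> a b x t (\<lambda>s. gamma_explicit s x t (p_star \<Phi> a b x t) a b) \<and>
    (\<forall>y. optimal_trajectory \<Phi> a b x t y \<longrightarrow>
      (\<forall>s\<in>{0..t}. y s = gamma_explicit s x t (p_star \<Phi> a b x t) a b)) \<and>
    optimal_value \<Phi> a b x t = V_sup \<Phi> a b x t"
proof -
  define g where "g r = - potential a b r" for r
  define \<gamma> where "\<gamma> p s = gamma_explicit s x t p a b" for p s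
  define V where "V p = V_explicit x t p a b" for p
  have ext: "dual_extremal g x t p (\<gamma> p) (V p)" for p
    using dual_extremal_gamma_explicit[OF assms(1,2,5)] unfolding g_def \<gamma>_def V_def .
  have g: "continuous_on UNIV g" unfolding g_def by (intro continuous_intros continuous_on_potential)
  have sup: "V_sup \<Phi> a b x t = (SUP p. ereal (V p) - legendre \<Phi> p)"
    by (simp add: V_sup_def dual_objective_def V_def)
  have cost: "cost \<Phi> a b t y = action g t y + \<Phi> (y 0)" for y
    by (simp add: cost_def action_def g_def)
  obtain p where
    max: "\<And>q. ereal (V q) - legendre \<Phi> q = V_sup \<Phi> a b x t \<longleftrightarrow> q = p"
    and opt: "ereal (cost \<Phi> a b t (\<gamma> p)) = V_sup \<Phi> a b x t"
    and lower: "\<And>z. z \<in> admissible x t \<Longrightarrow> V_sup \<Phi> a b x t \<le> ereal (cost \<Phi> a b t z)"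
    and unique: "\<And>z s. z \<in> admissible x t \<Longrightarrow> ereal (cost \<Phi> a b t z) = V_sup \<Phi> a b x t \<Longrightarrow>
      s \<in> {0..t} \<Longrightarrow> z s = \<gamma> p s"
    unfolding sup cost
  \<comment> \<open>Horizon and endpoint are fixed, so the momentum alone indexes the extremals; the
    gap hypothesis is discharged last, by \<open>dual_extremal_gap\<close>.\<close>
  proof (rule dual_attainment[OF assms(3,5), where \<gamma> = \<gamma> and V = V and C = "action g t" and A = "admissible x t"])
    show "\<gamma> p \<in> admissible x t" for p using ext by (rule dual_extremal_admissible)
    show "V p = action g t (\<gamma> p) + p * \<gamma> p 0" for p using ext by (simp add: dual_extremal_def)
    show "p = q" if "\<And>s. s \<in> {0..t} \<Longrightarrow> \<gamma> p s = \<gamma> q s" for p q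
      using ext ext assms(5) that by (rule dual_extremal_momentum_unique)
  qed (use dual_extremal_gap[OF ext assms(5) g] in blast)+
  have value_eq: "optimal_value \<Phi> a b x t = V_sup \<Phi> a b x t"
    unfolding optimal_value_def
  proof (rule antisym)
    show "(INF y\<in>admissible x t. ereal (cost \<Phi> a b t y)) \<le> V_sup \<Phi> a b x t"
      unfolding opt[symmetric] using dual_extremal_admissible[OF ext] by (rule INF_lower)
  qed (intro INF_greatest lower)
  have ismax: "is_maximizer \<Phi> a b x t q \<longleftrightarrow> q = p" for q
    using max[of q] by (simp add: is_maximizer_def dual_objective_def V_def)
  hence "p_star \<Phi> a b x t = p" by (simp add: p_star_def)
  moreover have "optimal_trajectory \<Phi> a b x t (\<gamma> p)"
    unfolding optimal_trajectory_def value_eq using opt dual_extremal_admissible[OF ext] by blast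
  moreover have "y s = \<gamma> p s" if "optimal_trajectory \<Phi> a b x t y" "s \<in> {0..t}" for y s
    using that unique unfolding optimal_trajectory_def value_eq by blast
  ultimately show ?thesis
    using ismax value_eq unfolding \<gamma>_def by auto
qed

end
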